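(* Let $\mathcal B=\mathrm{AC}$ and let $>$ be an AC-compatible reduction order used by both $\mathcal I_A$ and $\mathcal{KB}_{\mathrm{AC}}$. For every fair run $(\mathcal E,\varnothing)\vdash^*_{\mathcal I_A}(\varnothing,\mathcal R)$ there exists a run $(\mathcal E,\varnothing)\vdash^*_{\mathcal{KB}_{\mathrm{AC}}}(\varnothing,\mathcal R')$ such that $\mathcal R'/\mathrm{AC}$ is an AC-complete presentation of $\mathcal E$, i.e. $\mathcal R'$ is terminating modulo AC, $\leftrightarrow^*_{\mathcal E\cup\mathrm{AC}}=\leftrightarrow^*_{\mathcal R'\cup\mathrm{AC}}$, and $\leftrightarrow^*_{\mathcal R'\cup\mathrm{AC}}\subseteq\to^*_{\mathcal R'/\mathrm{AC}}\cdot\sim_{\mathrm{AC}}\cdot\leftarrow^*_{\mathcal R'/\mathrm{AC}}$.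
   Context: Terms over a signature $\mathcal F$ with a set of binary AC symbols; $\mathrm{AC}$ is the ES $\{f(x,y)\approx f(y,x),\ f(f(x,y),z)\approx f(x,f(y,z))\mid f\text{ an AC symbol}\}$. For a set $\mathcal E$ of pairs of terms (equations and rules read as oriented pairs), $s\to_{\mathcal E}t$ iff $s|_p=\ell\sigma$, $t=s[r\sigma]_p$ for some $(\ell,r)\in\mathcal E$, position $p$, substitution $\sigma$; $\leftarrow$ is the inverse, $\leftrightarrow$ the symmetric closure. With $\mathcal B$ a fixed ES satisfying $\mathrm{Var}(\ell)=\mathrm{Var}(r)$ for its equations (here $\mathcal B=\mathrm{AC}$): $\sim_{\mathcal B}=\leftrightarrow^*_{\mathcal B}$, $\mathcal B^\pm=\mathcal B\cup\{t\approx s\mid s\approx t\in\mathcal B\}$, $\to_{\mathcal R/\mathcal B}=\sim_{\mathcal B}\cdot\to_{\mathcal R}\cdot\sim_{\mathcal B}$, $s\downarrow^\sim_{\mathcal R}t$ iff $s\to^*_{\mathcal R}\cdot\sim_{\mathcal B}\cdot\leftarrow^*_{\mathcal R}t$; terminating modulo $\mathcal B$: no infinite $\to_{\mathcal R/\mathcal B}$-sequence. A $\mathcal B$-compatible reduction order is a well-founded order on terms closed under contexts and substitutions with $\sim_{\mathcal B}\cdot>\cdot\sim_{\mathcal B}\subseteq>$. Inference system $\mathcal I_A$ (parameterized by $>$) on pairs $(\mathcal E,\mathcal R)$ ($\uplus$ disjoint union, $s\approx^\pm t$ means $s\approx t$ or $t\approx s$): Deduce (peak): $(\mathcal E,\mathcal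 R)\vdash(\mathcal E\cup\{s\approx t\},\mathcal R)$ if $s\leftarrow_{\mathcal R}\cdot\to_{\mathcal R}t$. Deduce (cliff): $(\mathcal E,\mathcal R)\vdash(\mathcal E,\mathcal R\cup\{t\to s\})$ if $s\leftarrow_{\mathcal R}\cdot\leftrightarrow_{\mathcal B}t$. Orient: $(\mathcal E\uplus\{s\approx^\pm t\},\mathcal R)\vdash(\mathcal E,\mathcal R\cup\{s\to t\})$ if $s>t$. Delete: $(\mathcal E\uplus\{s\approx t\},\mathcal R)\vdash(\mathcal E,\mathcal R)$ if $s\sim_{\mathcal B}t$. Simplify: $(\mathcal E\uplus\{s\approx^\pm t\},\mathcal R)\vdash(\mathcal E\cup\{u\approx t\},\mathcal R)$ if $s\to_{\mathcal R/\mathcal B}u$. Collapse: $(\mathcal E,\mathcal R\uplus\{s\to t\})\vdash(\mathcal E\cup\{u\approx t\},\mathcal R)$ if $s\to_{\mathcal R}u$. Compose: $(\mathcal E,\mathcal R\uplus\{s\to t\})\vdash(\mathcal E,\mathcal R\cup\{s\to u\})$ if $t\to_{\mathcal R/\mathcal B}u$. The inference system $\mathcal{KB}_{\mathrm{AC}}$ is $\mathcal I_A$ with $\mathcal B=\mathrm{AC}$, except that Collapse may rewrite with $\to_{\mathcal R/\mathrm{AC}}$ (condition $s\to_{\mathcal R/\mathrm{AC}}u$), and the two Deduce rules are replaced by: $(\mathcal E,\mathcal R)\vdash(\mathcal E\cup\{s\approx t\},\mathcal R)$ if $s\leftarrow_{\mathcal R}\cdot\sim_{\mathrm{AC}}\cdot\to_{\mathcal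 R}t$. An $\mathcal I_A$-run for $\mathcal E$ goes from $(\mathcal E_0,\mathcal R_0)=(\mathcal E,\varnothing)$ to $(\mathcal E_n,\mathcal R_n)$; it is fair if $\mathcal R_n$ is left-linear, $\mathrm{PCP}(\mathcal R_n)\subseteq\ \downarrow^\sim_{\mathcal R_n}\cup\bigcup_{i=0}^n\leftrightarrow_{\mathcal E_i\cup\mathcal R_i}$ and $\mathrm{PCP}^\pm(\mathcal R_n,\mathcal B^\pm)\subseteq\ \downarrow^\sim_{\mathcal R_n}\cup\bigcup_{i=0}^n\leftrightarrow_{\mathcal R_i}$. Critical pairs: for sets of oriented pairs $\mathcal R_1,\mathcal R_2$, an overlap is $\langle\ell_1\to r_1,p,\ell_2\to r_2\rangle$ with $\ell_i\to r_i$ variants of elements of $\mathcal R_i$ without common variables, $p$ a non-variable position of $\ell_2$, $\ell_1,\ell_2|_p$ unifiable, rules not variants if $p=\epsilon$; with mgu $\sigma$ it yields the critical pair $\ell_2\sigma[r_1\sigma]_p\approx r_2\sigma$, prime if all proper subterms of $\ell_2\sigma|_p$ are normal forms w.r.t. the TRS under consideration. $\mathrm{PCP}(\mathcal R)$: prime critical pairs of $\mathcal R$ with itself; $\mathrm{PCP}^\pm(\mathcal R,\mathcal B^\pm)$: prime critical pairs between $\mathcal R$ and $\mathcal B^\pm$ in either order. *)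

theory Defs
  imports Main
begin

datatype ('f, 'v) "term" = Var 'v | Fun 'f "('f, 'v) term list"

type_synonym ('f, 'v) rule = "('f, 'v) term \<times> ('f, 'v) term"
type_synonym ('f, 'v) trs = "('f, 'v) rule set"
type_synonym pos = "nat list"

fun subst :: "('v \<Rightarrow> ('f, 'v) term) \<Rightarrow> ('f, 'v) term \<Rightarrow> ('f, 'v) term" where
  "subst \<sigma> (Var x) = \<sigma> x"
| "subst \<sigma> (Fun f ts) = Fun f (map (subst \<sigma>) ts)"

definition subst_comp ::
  "('v \<Rightarrow> ('f, 'v) term) \<Rightarrow> ('v \<Rightarrow> ('f, 'v) term) \<Rightarrow> ('v \<Rightarrow> ('f, 'v) term)" where
  "subst_comp \<sigma> \<tau> = (\<lambda>x. subst \<tau> (\<sigma> x))"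

fun vars_list :: "('f, 'v) term \<Rightarrow> 'v list" where
  "vars_list (Var x) = [x]"
| "vars_list (Fun f ts) = concat (map vars_list ts)"

definition linear_term :: "('f, 'v) term \<Rightarrow> bool" where
  "linear_term t = distinct (vars_list t)"

definition left_linear :: "('f, 'v) trs \<Rightarrow> bool" where
  "left_linear R = (\<forall>(l, r) \<in> R. linear_term l)"

function poss :: "('f, 'v) term \<Rightarrow> pos set" where
  "poss (Var x) = {[]}"
| "poss (Fun f ts) = insert [] (\<Union>i \<in> {..<length ts}. (#) i ` poss (ts ! i))"
  by pat_completeness auto
termination
  by (relation "measure size") (auto simp: elim!: nth_mem[THEN size_list_estimation', rotated] intro: less_Suc_eq_le[THEN iffD2] size_list_estimation' nth_mem)

fun subt_at :: "('f, 'v) term \<Rightarrow> pos \<Rightarrow> ('f, 'v) term" where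
  "subt_at t [] = t"
| "subt_at (Fun f ts) (i # p) = subt_at (ts ! i) p"
| "subt_at (Var x) (i # p) = Var x"

fun replace_at :: "('f, 'v) term \<Rightarrow> pos \<Rightarrow> ('f, 'v) term \<Rightarrow> ('f, 'v) term" where
  "replace_at t [] s = s"
| "replace_at (Fun f ts) (i # p) s = Fun f (ts[i := replace_at (ts ! i) p s])"
| "replace_at (Var x) (i # p) s = Var x"

definition is_Fun :: "('f, 'v) term \<Rightarrow> bool" where
  "is_Fun t = (\<exists>f ts. t = Fun f ts)"

definition fun_poss :: "('f, 'v) term \<Rightarrow> pos set" where
  "fun_poss t = {p \<in> poss t. is_Fun (subt_at t p)}"

definition rstep :: "('f, 'v) trs \<Rightarrow> ('f, 'v) term rel" where
  "rstep R = {(s, t). \<exists>l r p \<sigma>. (l, r) \<in> R \<and> p \<in> poss s \<and>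
      subt_at s p = subst \<sigma> l \<and> t = replace_at s p (subst \<sigma> r)}"

definition sstep :: "('f, 'v) trs \<Rightarrow> ('f, 'v) term rel" where
  "sstep E = rstep E \<union> (rstep E)\<inverse>"

definition conv :: "('f, 'v) trs \<Rightarrow> ('f, 'v) term rel" where
  "conv E = (sstep E)\<^sup>*"

definition relmod :: "('f, 'v) trs \<Rightarrow> ('f, 'v) trs \<Rightarrow> ('f, 'v) term rel" where
  "relmod R B = conv B O rstep R O conv B"

definition join_mod :: "('f, 'v) trs \<Rightarrow> ('f, 'v) trs \<Rightarrow> ('f, 'v) term rel" where
  "join_mod R B = (rstep R)\<^sup>* O conv B O ((rstep R)\<inverse>)\<^sup>*"

definition SN_rel :: "'a rel \<Rightarrow> bool" where
  "SN_rel r = (\<not> (\<exists>f. \<forall>i. (f i, f (Suc i)) \<in> r))"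

definition NF :: "('f, 'v) trs \<Rightarrow> ('f, 'v) term \<Rightarrow> bool" where
  "NF R t = (\<nexists>u. (t, u) \<in> rstep R)"

text \<open>The equational system AC for the set \<open>F\<close> of binary AC symbols
  (all variants of the commutativity and associativity equations).\<close>
definition AC :: "'f set \<Rightarrow> ('f, 'v) trs" where
  "AC F = {(l, r). \<exists>f \<in> F. \<exists>x y z. distinct [x, y, z] \<and>
      ((l = Fun f [Var x, Var y] \<and> r = Fun f [Var y, Var x]) \<or>
       (l = Fun f [Fun f [Var x, Var y], Var z] \<and> r = Fun f [Var x, Fun f [Var y, Var z]]))}"

definition pm :: "('f, 'v) trs \<Rightarrow> ('f, 'v) trs" where
  "pm B = B \<union> B\<inverse>"

text \<open>\<open>B\<close>-compatible reduction order (strict order given as a relation \<open>gt\<close>,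
  \<open>(s, t) \<in> gt\<close> meaning \<open>s > t\<close>).\<close>
definition reduction_order_mod :: "('f, 'v) trs \<Rightarrow> ('f, 'v) term rel \<Rightarrow> bool" where
  "reduction_order_mod B gt \<longleftrightarrow>
     irrefl gt \<and> trans gt \<and> wf (gt\<inverse>) \<and>
     (\<forall>s t u p. (s, t) \<in> gt \<and> p \<in> poss u \<longrightarrow> (replace_at u p s, replace_at u p t) \<in> gt) \<and>
     (\<forall>s t \<sigma>. (s, t) \<in> gt \<longrightarrow> (subst \<sigma> s, subst \<sigma> t) \<in> gt) \<and>
     conv B O gt O conv B \<subseteq> gt"

definition renaming :: "('v \<Rightarrow> 'v) \<Rightarrow> bool" where
  "renaming \<pi> = bij \<pi>"

definition variant :: "('f, 'v) rule \<Rightarrow> ('f, 'v) rule \<Rightarrow> bool" where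
  "variant lr' lr \<longleftrightarrow> (\<exists>\<pi>. renaming \<pi> \<and>
      fst lr' = subst (Var \<circ> \<pi>) (fst lr) \<and> snd lr' = subst (Var \<circ> \<pi>) (snd lr))"

definition rule_vars :: "('f, 'v) rule \<Rightarrow> 'v set" where
  "rule_vars lr = set (vars_list (fst lr)) \<union> set (vars_list (snd lr))"

definition is_mgu :: "('v \<Rightarrow> ('f, 'v) term) \<Rightarrow> ('f, 'v) term \<Rightarrow> ('f, 'v) term \<Rightarrow> bool" where
  "is_mgu \<sigma> s t \<longleftrightarrow> subst \<sigma> s = subst \<sigma> t \<and>
     (\<forall>\<tau>. subst \<tau> s = subst \<tau> t \<longrightarrow> (\<exists>\<delta>. \<tau> = subst_comp \<sigma> \<delta>))"

definition overlap :: "('f, 'v) trs \<Rightarrow> ('f, 'v) trs \<Rightarrow> ('f, 'v) rule \<Rightarrow> pos \<Rightarrow> ('f, 'v) rule \<Rightarrow> bool" where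
  "overlap R1 R2 lr1 p lr2 \<longleftrightarrow>
     (\<exists>lr \<in> R1. variant lr1 lr) \<and> (\<exists>lr \<in> R2. variant lr2 lr) \<and>
     rule_vars lr1 \<inter> rule_vars lr2 = {} \<and>
     p \<in> fun_poss (fst lr2) \<and>
     (\<exists>\<sigma>. subst \<sigma> (fst lr1) = subst \<sigma> (subt_at (fst lr2) p)) \<and>
     (p = [] \<longrightarrow> \<not> variant lr1 lr2)"

text \<open>Prime critical pairs between \<open>R1\<close> and \<open>R2\<close>, primality being
  w.r.t. the TRS \<open>S\<close> under consideration.\<close>
definition PCP2 :: "('f, 'v) trs \<Rightarrow> ('f, 'v) trs \<Rightarrow> ('f, 'v) trs \<Rightarrow> ('f, 'v) term rel" where
  "PCP2 S R1 R2 = {(s, t). \<exists>l1 r1 p l2 r2 \<sigma>.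
      overlap R1 R2 (l1, r1) p (l2, r2) \<and> is_mgu \<sigma> l1 (subt_at l2 p) \<and>
      s = replace_at (subst \<sigma> l2) p (subst \<sigma> r1) \<and> t = subst \<sigma> r2 \<and>
      (\<forall>q \<in> poss (subt_at (subst \<sigma> l2) p). q \<noteq> [] \<longrightarrow>
          NF S (subt_at (subt_at (subst \<sigma> l2) p) q))}"

definition PCP :: "('f, 'v) trs \<Rightarrow> ('f, 'v) term rel" where
  "PCP R = PCP2 R R R"

definition PCPpm :: "('f, 'v) trs \<Rightarrow> ('f, 'v) trs \<Rightarrow> ('f, 'v) term rel" where
  "PCPpm R B = PCP2 R R B \<union> PCP2 R B R"

type_synonym ('f, 'v) state = "('f, 'v) trs \<times> ('f, 'v) trs"

inductive IA_step :: "('f, 'v) trs \<Rightarrow> ('f, 'v) term rel \<Rightarrow> ('f, 'v) state \<Rightarrow> ('f, 'v) state \<Rightarrow> bool"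
  for B gt where
  deduce_peak: "(s, t) \<in> (rstep R)\<inverse> O rstep R \<Longrightarrow>
     IA_step B gt (E, R) (E \<union> {(s, t)}, R)"
| deduce_cliff: "(s, t) \<in> (rstep R)\<inverse> O sstep B \<Longrightarrow>
     IA_step B gt (E, R) (E, R \<union> {(t, s)})"
| orient: "e \<in> E \<Longrightarrow> e = (s, t) \<or> e = (t, s) \<Longrightarrow> (s, t) \<in> gt \<Longrightarrow>
     IA_step B gt (E, R) (E - {e}, R \<union> {(s, t)})"
| delete: "(s, t) \<in> E \<Longrightarrow> (s, t) \<in> conv B \<Longrightarrow>
     IA_step B gt (E, R) (E - {(s, t)}, R)"
| simplify: "e \<in> E \<Longrightarrow> e = (s, t) \<or> e = (t, s) \<Longrightarrow> (s, u) \<in> relmod R B \<Longrightarrow>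
     IA_step B gt (E, R) ((E - {e}) \<union> {(u, t)}, R)"
| collapse: "(s, t) \<in> R \<Longrightarrow> (s, u) \<in> rstep (R - {(s, t)}) \<Longrightarrow>
     IA_step B gt (E, R) (E \<union> {(u, t)}, R - {(s, t)})"
| compose: "(s, t) \<in> R \<Longrightarrow> (t, u) \<in> relmod (R - {(s, t)}) B \<Longrightarrow>
     IA_step B gt (E, R) (E, (R - {(s, t)}) \<union> {(s, u)})"

inductive KBAC_step :: "'f set \<Rightarrow> ('f, 'v) term rel \<Rightarrow> ('f, 'v) state \<Rightarrow> ('f, 'v) state \<Rightarrow> bool"
  for F gt where
  deduce: "(s, t) \<in> (rstep R)\<inverse> O conv (AC F) O rstep R \<Longrightarrow>
     KBAC_step F gt (E, R) (E \<union> {(s, t)}, R)"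
| orient: "e \<in> E \<Longrightarrow> e = (s, t) \<or> e = (t, s) \<Longrightarrow> (s, t) \<in> gt \<Longrightarrow>
     KBAC_step F gt (E, R) (E - {e}, R \<union> {(s, t)})"
| delete: "(s, t) \<in> E \<Longrightarrow> (s, t) \<in> conv (AC F) \<Longrightarrow>
     KBAC_step F gt (E, R) (E - {(s, t)}, R)"
| simplify: "e \<in> E \<Longrightarrow> e = (s, t) \<or> e = (t, s) \<Longrightarrow> (s, u) \<in> relmod R (AC F) \<Longrightarrow>
     KBAC_step F gt (E, R) ((E - {e}) \<union> {(u, t)}, R)"
| collapse: "(s, t) \<in> R \<Longrightarrow> (s, u) \<in> relmod (R - {(s, t)}) (AC F) \<Longrightarrow>
     KBAC_step F gt (E, R) (E \<union> {(u, t)}, R - {(s, t)})"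
| compose: "(s, t) \<in> R \<Longrightarrow> (t, u) \<in> relmod (R - {(s, t)}) (AC F) \<Longrightarrow>
     KBAC_step F gt (E, R) (E, (R - {(s, t)}) \<union> {(s, u)})"

definition run :: "(('f, 'v) state \<Rightarrow> ('f, 'v) state \<Rightarrow> bool) \<Rightarrow> ('f, 'v) trs \<Rightarrow>
    (nat \<Rightarrow> ('f, 'v) state) \<Rightarrow> nat \<Rightarrow> bool" where
  "run step E S n \<longleftrightarrow> S 0 = (E, {}) \<and> (\<forall>i < n. step (S i) (S (Suc i)))"

definition fair_run :: "('f, 'v) trs \<Rightarrow> (nat \<Rightarrow> ('f, 'v) state) \<Rightarrow> nat \<Rightarrow> bool" where
  "fair_run B S n \<longleftrightarrow>
     (let Rn = snd (S n) in
       left_linear Rn \<and>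
       PCP Rn \<subseteq> join_mod Rn B \<union> (\<Union>i \<le> n. sstep (fst (S i) \<union> snd (S i))) \<and>
       PCPpm Rn (pm B) \<subseteq> join_mod Rn B \<union> (\<Union>i \<le> n. sstep (snd (S i))))"

end

theory Submission
  imports Defs
begin

text \<open>
  Let \<open>R\<close> be the final system of the fair run. Going backwards through the run, every equation
  that ever occurred is replaced by a conversion over \<open>R\<close> and AC bounded by its two sides, and every
  rule \<open>l \<rightarrow> r\<close> by an \<open>R\<close>-step from \<open>l\<close> followed by a conversion strictly below \<open>l\<close>. With fairness
  this makes every local peak \<open>s \<leftarrow> u \<rightarrow> t\<close> convertible strictly below \<open>u\<close>, and provides for every local
  cliff \<open>s \<leftarrow> u \<leftrightarrow> t\<close> a step \<open>t \<rightarrow> t'\<close> with \<open>t'\<close> and \<open>s\<close> convertible strictly below \<open>u\<close>. Well-founded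
  induction then shows that AC-equivalent terms have AC-equivalent \<open>R\<close>-normal forms, whence \<open>R\<close> is
  Church-Rosser modulo AC.

  The AC completion run keeps all its rules forever and only imitates orientations. All other rules
  and equations of the original run are reachable from these by rewriting modulo AC, so the resulting
  system simulates \<open>R\<close> and inherits the Church-Rosser property. Surplus equations are valid, hence
  joinable in the end, and can be simplified and deleted.
\<close>

section \<open>Terms, positions and linear unification\<close>

text \<open>Equations and rules are replaced differently because of an asymmetry. Both ends of a
  peak \<open>s <- u -> t\<close> lie below \<open>u\<close>, so a conversion bounded by
  \<open>s\<close> and \<open>t\<close> stays below \<open>u\<close>. In a cliff
  \<open>s <- u <-> t\<close> the term \<open>t\<close> is AC-equivalent to \<open>u\<close>, and a
  conversion bounded by \<open>s\<close> and \<open>t\<close> could run through terms as large as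
  \<open>u\<close>, out of reach of the induction. A rewrite step out of \<open>t\<close> is
  required, which rules provide and equations do not; hence fairness lets cliffs be covered only by
  rules of the run, but peaks also by its equations.

  The simulation cannot copy the run inference by inference. A rule \<open>t -> s\<close> made by
  Deduce (cliff) has no counterpart in AC completion; it is subsumed by rewriting modulo AC, but
  only as long as the rules that rewrite \<open>u\<close> to \<open>s\<close> survive. Removing a
  rule whenever the given run does would destroy the cliff rules that rest on it. Once all rules are
  kept, the equation left by Collapse has two reducts of one term as its sides, so Deduce can
  produce it whenever it is wanted.\<close>

declare poss.simps(2)[simp del]

lemma Cons_poss_Fun [simp]: "i # p \<in> poss (Fun f ts) \<longleftrightarrow> i < length ts \<and> p \<in> poss (ts ! i)"
  by (auto simp: poss.simps(2))

lemma Nil_poss [simp]: "[] \<in> poss t"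
  by (cases t) (auto simp: poss.simps(2))

lemma poss_append: "p @ q \<in> poss t \<longleftrightarrow> p \<in> poss t \<and> q \<in> poss (subt_at t p)"
  by (induction t p rule: subt_at.induct) auto

lemma subt_at_append: "p \<in> poss t \<Longrightarrow> subt_at t (p @ q) = subt_at (subt_at t p) q"
  by (induction t p rule: subt_at.induct) auto

lemma subt_at_replace_at [simp]: "p \<in> poss t \<Longrightarrow> subt_at (replace_at t p s) p = s"
  by (induction t p rule: subt_at.induct) auto

lemma poss_replace_at [simp]: "p \<in> poss t \<Longrightarrow> p \<in> poss (replace_at t p s)"
  by (induction t p rule: subt_at.induct) auto

lemma replace_at_subt_at [simp]: "p \<in> poss t \<Longrightarrow> replace_at t p (subt_at t p) = t"
  by (induction t p rule: subt_at.induct) auto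

lemma replace_at_replace_at [simp]:
  "p \<in> poss t \<Longrightarrow> replace_at (replace_at t p s) p u = replace_at t p u"
  by (induction t p rule: subt_at.induct) auto

lemma replace_at_append:
  "p \<in> poss t \<Longrightarrow> replace_at t (p @ q) s = replace_at t p (replace_at (subt_at t p) q s)"
  by (induction t p rule: subt_at.induct) auto

lemma replace_at_below:
  "p \<in> poss t \<Longrightarrow> replace_at (replace_at t p s) (p @ q) u = replace_at t p (replace_at s q u)"
  by (simp add: replace_at_append)

lemma subst_subst: "subst \<tau> (subst \<sigma> t) = subst (subst_comp \<sigma> \<tau>) t"
  by (induction t) (auto simp: subst_comp_def)

lemma subst_Var [simp]: "subst Var t = t"
  by (induction t) (auto simp: map_idI)

lemma subst_cong_iff: "subst \<sigma> t = subst \<tau> t \<longleftrightarrow> (\<forall>x \<in> set (vars_list t). \<sigma> x = \<tau> x)"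
  by (induction t) auto

lemma poss_subst [simp]: "p \<in> poss t \<Longrightarrow> p \<in> poss (subst \<sigma> t)"
  by (induction t p rule: subt_at.induct) auto

lemma subt_at_subst [simp]: "p \<in> poss t \<Longrightarrow> subt_at (subst \<sigma> t) p = subst \<sigma> (subt_at t p)"
  by (induction t p rule: subt_at.induct) auto

lemma replace_at_subst:
  "p \<in> poss t \<Longrightarrow> subst \<sigma> (replace_at t p s) = replace_at (subst \<sigma> t) p (subst \<sigma> s)"
  by (induction t p rule: subt_at.induct) (auto simp: map_update)

lemma poss_subst_cases:
  assumes "p \<in> poss (subst \<sigma> t)"
  obtains (func) "p \<in> fun_poss t"
  | (var) q1 q2 x where "p = q1 @ q2" "q1 \<in> poss t" "subt_at t q1 = Var x" "q2 \<in> poss (\<sigma> x)"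
proof -
  have "p \<in> fun_poss t \<or>
    (\<exists>q1 q2 x. p = q1 @ q2 \<and> q1 \<in> poss t \<and> subt_at t q1 = Var x \<and> q2 \<in> poss (\<sigma> x))"
    using assms
  proof (induction t p rule: subt_at.induct)
    case (1 t)
    then show ?case by (cases t) (auto simp: fun_poss_def is_Fun_def)
  next
    case (2 f ts i p)
    then have i: "i < length ts" and p: "p \<in> poss (subst \<sigma> (ts ! i))" by auto
    from 2(1)[OF p] show ?case
    proof (elim disjE exE conjE)
      assume "p \<in> fun_poss (ts ! i)"
      then show ?thesis using i by (auto simp: fun_poss_def)
    next
      fix q1 q2 x
      assume "p = q1 @ q2" "q1 \<in> poss (ts ! i)" "subt_at (ts ! i) q1 = Var x" "q2 \<in> poss (\<sigma> x)"
      then have "i # p = (i # q1) @ q2" "i # q1 \<in> poss (Fun f ts)"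
        "subt_at (Fun f ts) (i # q1) = Var x" using i by auto
      then show ?thesis using \<open>q2 \<in> poss (\<sigma> x)\<close> by blast
    qed
  next
    case (3 x i p)
    then show ?case by (auto intro!: exI[of _ "[]"])
  qed
  then show thesis using that by blast
qed

lemma vars_list_poss:
  "x \<in> set (vars_list t) \<Longrightarrow> \<exists>p \<in> poss t. subt_at t p = Var x"
proof (induction t)
  case (Fun f ts)
  then obtain s where s: "s \<in> set ts" "x \<in> set (vars_list s)" by auto
  then obtain i where i: "i < length ts" "ts ! i = s" by (auto simp: in_set_conv_nth)
  from Fun.IH[OF s] obtain p where "p \<in> poss s" "subt_at s p = Var x" by blast
  then show ?case using i by (intro bexI[of _ "i # p"]) auto
qed simp

lemma poss_vars_list: "p \<in> poss t \<Longrightarrow> subt_at t p = Var x \<Longrightarrow> x \<in> set (vars_list t)"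
  by (induction t p rule: subt_at.induct) auto

section \<open>Independent positions, linear terms and their unifiers\<close>

lemma parallel_replace_at:
  assumes "p \<in> poss t" "q \<in> poss t" "\<not> (\<exists>r. q = p @ r)" "\<not> (\<exists>r. p = q @ r)"
  shows "q \<in> poss (replace_at t p s) \<and> subt_at (replace_at t p s) q = subt_at t q \<and>
    replace_at (replace_at t p s) q u = replace_at (replace_at t q u) p s"
  using assms
proof (induction p arbitrary: t q)
  case (Cons i p)
  then obtain f ts where t: "t = Fun f ts" by (cases t) auto
  from Cons.prems obtain j q' where q: "q = j # q'" by (cases q) auto
  show ?case
  proof (cases "i = j")
    case True
    then show ?thesis using Cons.prems Cons.IH[of "ts ! i" q'] t q by auto
  next
    case False
    then show ?thesis using Cons.prems t q by (auto simp: list_update_swap)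
  qed
qed simp

lemma distinct_concat_nth:
  "distinct (concat xss) \<Longrightarrow> i < length xss \<Longrightarrow> j < length xss \<Longrightarrow> i \<noteq> j \<Longrightarrow>
    set (xss ! i) \<inter> set (xss ! j) = {}"
proof (induction xss arbitrary: i j)
  case (Cons xs xss)
  then have disj: "\<And>k. k < length xss \<Longrightarrow> set xs \<inter> set (xss ! k) = {}" by fastforce
  show ?case using Cons.prems Cons.IH disj by (cases i; cases j) (auto simp: Int_commute)
qed simp

lemma linear_nth: "linear_term (Fun f ts) \<Longrightarrow> i < length ts \<Longrightarrow> linear_term (ts ! i)"
  by (auto simp: linear_term_def distinct_concat_iff)

lemma linear_nth_disjoint:
  assumes "linear_term (Fun f ts)" "i < length ts" "j < length ts" "i \<noteq> j"
  shows "set (vars_list (ts ! i)) \<inter> set (vars_list (ts ! j)) = {}"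
  using distinct_concat_nth[of "map vars_list ts" i j] assms by (auto simp: linear_term_def)

lemma linear_subt_at: "linear_term t \<Longrightarrow> p \<in> poss t \<Longrightarrow> linear_term (subt_at t p)"
  by (induction t p rule: subt_at.induct) (auto dest: linear_nth)

text \<open>By linearity \<open>q1\<close> is the only occurrence of \<open>x\<close>, so no second
  copy of \<open>\<sigma> x\<close> has to change along with it. Left-linearity enters the treatment
  of variable overlaps through this fact.\<close>

lemma replace_at_linear_subst:
  assumes "linear_term t" "q1 \<in> poss t" "subt_at t q1 = Var x"
  shows "replace_at (subst \<sigma> t) (q1 @ q2) v = subst (\<sigma>(x := replace_at (\<sigma> x) q2 v)) t"
  using assms
proof (induction t q1 rule: subt_at.induct)
  case (2 f ts i p)
  let ?\<sigma> = "\<sigma>(x := replace_at (\<sigma> x) q2 v)"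
  have i: "i < length ts" and p: "p \<in> poss (ts ! i)" and x: "subt_at (ts ! i) p = Var x"
    using 2 by auto
  have lin: "linear_term (ts ! i)" using linear_nth[OF 2(2) i] .
  have xi: "x \<in> set (vars_list (ts ! i))" using poss_vars_list[OF p x] .
  have "map (subst \<sigma>) ts ! j = subst ?\<sigma> (ts ! j)" if "j < length ts" "j \<noteq> i" for j
    using linear_nth_disjoint[OF 2(2) i that(1)] that xi by (auto simp: subst_cong_iff)
  then have "(map (subst \<sigma>) ts)[i := subst ?\<sigma> (ts ! i)] = map (subst ?\<sigma>) ts"
    using i by (intro nth_equalityI) (simp_all add: nth_list_update del: fun_upd_apply)
  then show ?case using 2(1)[OF lin p x] i by (simp del: fun_upd_apply)
qed auto

text \<open>Bindings never have to be propagated: corresponding arguments form unification problems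
  with disjoint variables, whose solutions can be glued together without occurs check or termination
  measure. Since every unifier absorbs \<open>\<sigma>\<close>, it is its own witness for
  \<open>is_mgu\<close>.\<close>

lemma linear_mgu:
  assumes "linear_term s" "linear_term t" "set (vars_list s) \<inter> set (vars_list t) = {}"
    and "subst \<tau> s = subst \<tau> t"
  shows "\<exists>\<sigma>. subst \<sigma> s = subst \<sigma> t \<and>
    (\<forall>\<tau>. subst \<tau> s = subst \<tau> t \<longrightarrow> (\<forall>x. subst \<tau> (\<sigma> x) = \<tau> x))"
  using assms
proof (induction s arbitrary: t)
  case (Var x)
  then have "subst (Var(x := t)) t = subst Var t" by (subst subst_cong_iff) auto
  moreover define \<sigma> where "\<sigma> = Var(x := t)"
  ultimately have "subst \<sigma> (Var x) = subst \<sigma> t" by simp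
  moreover have "subst \<rho> (\<sigma> y) = \<rho> y" if "subst \<rho> (Var x) = subst \<rho> t" for \<rho> y
    using that by (simp add: \<sigma>_def)
  ultimately show ?case by blast
next
  case (Fun f ss)
  show ?case
  proof (cases t)
    case (Var y)
    then have "subst (Var(y := Fun f ss)) (Fun f ss) = subst Var (Fun f ss)"
      using Fun.prems by (subst subst_cong_iff) auto
    moreover define \<sigma> where "\<sigma> = Var(y := Fun f ss)"
    ultimately have "subst \<sigma> (Fun f ss) = subst \<sigma> t" using Var by (simp add: map_idI)
    moreover have "subst \<rho> (\<sigma> z) = \<rho> z" if "subst \<rho> (Fun f ss) = subst \<rho> t" for \<rho> z
      using that Var by (simp add: \<sigma>_def)
    ultimately show ?thesis by blast
  next
    case (Fun g ts)
    note t = this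
    have fg: "g = f" and len: "length ts = length ss" using Fun.prems(4) t
      by (simp_all add: list_eq_iff_nth_eq)
    have tau: "subst \<tau> (ss ! i) = subst \<tau> (ts ! i)" if "i < length ss" for i
      using Fun.prems(4) t that len by (simp add: list_eq_iff_nth_eq)
    let ?P = "\<lambda>i \<sigma>. subst \<sigma> (ss ! i) = subst \<sigma> (ts ! i) \<and>
      (\<forall>\<tau>. subst \<tau> (ss ! i) = subst \<tau> (ts ! i) \<longrightarrow> (\<forall>x. subst \<tau> (\<sigma> x) = \<tau> x))"
    have cross: "x \<notin> set (vars_list (ts ! k'))"
      if "x \<in> set (vars_list (ss ! k))" "k < length ss" "k' < length ss" for x k k'
    proof -
      have "x \<in> set (vars_list (Fun f ss))" using that nth_mem[of k ss] by auto
      moreover have "x \<in> set (vars_list t)" if "x \<in> set (vars_list (ts ! k'))"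
        using that \<open>k' < length ss\<close> len t nth_mem[of k' ts] by auto
      ultimately show ?thesis using Fun.prems(3) by blast
    qed
    have "\<exists>\<sigma>. ?P i \<sigma>" if i: "i < length ss" for i
    proof (rule Fun.IH)
      show "ss ! i \<in> set ss" using i by simp
      show "linear_term (ss ! i)" using linear_nth[OF Fun.prems(1) i] .
      show "linear_term (ts ! i)" using linear_nth[of g ts i] Fun.prems(2) t i len by simp
      show "set (vars_list (ss ! i)) \<inter> set (vars_list (ts ! i)) = {}"
        using cross i by blast
      show "subst \<tau> (ss ! i) = subst \<tau> (ts ! i)" using tau[OF i] .
    qed
    then obtain \<Sigma> where \<Sigma>: "\<And>i. i < length ss \<Longrightarrow> ?P i (\<Sigma> i)" by metis
    let ?V = "\<lambda>i. set (vars_list (ss ! i)) \<union> set (vars_list (ts ! i))"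
    \<comment> \<open>A variable belongs to at most one argument pair (\<open>disj\<close>), so the
      choice of \<open>i\<close> is forced.\<close>
    define \<sigma> where "\<sigma> x = (if \<exists>i < length ss. x \<in> ?V i
      then \<Sigma> (SOME i. i < length ss \<and> x \<in> ?V i) x else Var x)" for x
    have disj: "i = j" if "i < length ss" "j < length ss" "x \<in> ?V i" "x \<in> ?V j" for i j x
    proof (rule ccontr)
      assume "i \<noteq> j"
      then show False
        using that cross[of x i j] cross[of x j i] linear_nth_disjoint[OF Fun.prems(1), of i j]
          linear_nth_disjoint[of g ts i j] Fun.prems(2) t len by auto
    qed
    have \<sigma>: "\<sigma> x = \<Sigma> i x" if "i < length ss" "x \<in> ?V i" for i x
    proof -
      have "(SOME i. i < length ss \<and> x \<in> ?V i) = i"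
        using that disj by (intro some_equality) auto
      then show ?thesis using that unfolding \<sigma>_def by auto
    qed
    have "subst \<sigma> (ss ! i) = subst \<sigma> (ts ! i)" if i: "i < length ss" for i
    proof -
      have "subst \<sigma> (ss ! i) = subst (\<Sigma> i) (ss ! i)" "subst \<sigma> (ts ! i) = subst (\<Sigma> i) (ts ! i)"
        using \<sigma>[OF i] by (auto simp: subst_cong_iff)
      then show ?thesis using \<Sigma>[OF i] by simp
    qed
    then have 1: "subst \<sigma> (Fun f ss) = subst \<sigma> t" using t fg len
      by (auto intro: nth_equalityI)
    have 2: "subst \<rho> (\<sigma> x) = \<rho> x" if "subst \<rho> (Fun f ss) = subst \<rho> t" for \<rho> x
    proof -
      have "subst \<rho> (ss ! i) = subst \<rho> (ts ! i)" if "i < length ss" for i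
        using \<open>subst \<rho> (Fun f ss) = subst \<rho> t\<close> t that len
        by (simp add: list_eq_iff_nth_eq)
      then have *: "subst \<rho> (\<Sigma> i x) = \<rho> x" if "i < length ss" for i using \<Sigma> that by blast
      show ?thesis
      proof (cases "\<exists>i < length ss. x \<in> ?V i")
        case True
        then obtain i where "i < length ss" "x \<in> ?V i" by blast
        then show ?thesis using \<sigma> * by metis
      next
        case False
        then show ?thesis unfolding \<sigma>_def by (simp only: if_False subst.simps)
      qed
    qed
    from 1 2 show ?thesis by blast
  qed
qed

lemma fresh_renaming:
  assumes "infinite (UNIV :: 'v set)" "finite (A :: 'v set)" "finite (V :: 'v set)"
  shows "\<exists>\<pi>. bij \<pi> \<and> \<pi> ` A \<inter> V = {}"
proof -
  have "infinite (UNIV - (A \<union> V))" using assms by (simp add: Diff_infinite_finite)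
  then obtain C where C: "C \<subseteq> UNIV - (A \<union> V)" "card C = card A" "finite C"
    using infinite_arbitrarily_large[of "UNIV - (A \<union> V)" "card A"] by metis
  then obtain g where g: "bij_betw g A C"
    using assms(2) finite_same_card_bij[of A C] by auto
  \<comment> \<open>Variants are formed by bijections of all variables, so \<open>A\<close> is not
    merely mapped into the fresh set \<open>C\<close>: the two sets are swapped, which gives an
    involution.\<close>
  define \<pi> where "\<pi> x = (if x \<in> A then g x else if x \<in> C then inv_into A g x else x)" for x
  have gA: "g x \<in> C" if "x \<in> A" for x using g that by (auto simp: bij_betw_def)
  have iC: "inv_into A g x \<in> A" if "x \<in> C" for x
    using g that by (auto simp: bij_betw_def inv_into_into)
  have "\<pi> (\<pi> x) = x" for x
    using gA iC C(1) g by (auto simp: \<pi>_def bij_betw_inv_into_left bij_betw_inv_into_right)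
  then have "bij \<pi>" by (rule involuntory_imp_bij)
  moreover have "\<pi> ` A \<inter> V = {}" using gA C(1) by (auto simp: \<pi>_def)
  ultimately show ?thesis by blast
qed

section \<open>Rewrite steps and critical overlaps\<close>

definition stable :: "('f, 'v) term rel \<Rightarrow> bool" where
  "stable r \<longleftrightarrow>
    (\<forall>s t u p. (s, t) \<in> r \<longrightarrow> p \<in> poss u \<longrightarrow> (replace_at u p s, replace_at u p t) \<in> r) \<and>
    (\<forall>s t \<sigma>. (s, t) \<in> r \<longrightarrow> (subst \<sigma> s, subst \<sigma> t) \<in> r)"

lemma stable_ctxt:
  "stable r \<Longrightarrow> (s, t) \<in> r \<Longrightarrow> p \<in> poss u \<Longrightarrow> (replace_at u p s, replace_at u p t) \<in> r"
  by (auto simp: stable_def)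

lemma stable_subst: "stable r \<Longrightarrow> (s, t) \<in> r \<Longrightarrow> (subst \<sigma> s, subst \<sigma> t) \<in> r"
  by (auto simp: stable_def)

lemma stable_relcomp: "stable r \<Longrightarrow> stable r' \<Longrightarrow> stable (r O r')"
  unfolding stable_def by (intro conjI allI impI; elim relcompE; blast)

lemma stable_Un: "stable r \<Longrightarrow> stable r' \<Longrightarrow> stable (r \<union> r')"
  unfolding stable_def by blast

lemma stable_converse: "stable r \<Longrightarrow> stable (r\<inverse>)"
  unfolding stable_def by blast

lemma stable_rtrancl:
  assumes "stable r"
  shows "stable (r\<^sup>*)"
proof -
  have "(s, t) \<in> r\<^sup>* \<Longrightarrow> p \<in> poss u \<Longrightarrow> (replace_at u p s, replace_at u p t) \<in> r\<^sup>*" for s t u p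
    by (induction rule: rtrancl_induct) (auto intro: rtrancl_into_rtrancl stable_ctxt[OF assms])
  moreover have "(s, t) \<in> r\<^sup>* \<Longrightarrow> (subst \<sigma> s, subst \<sigma> t) \<in> r\<^sup>*" for s t \<sigma>
    by (induction rule: rtrancl_induct) (auto intro: rtrancl_into_rtrancl stable_subst[OF assms])
  ultimately show ?thesis unfolding stable_def by blast
qed

lemma rstepI:
  "(l, r) \<in> R \<Longrightarrow> p \<in> poss s \<Longrightarrow> subt_at s p = subst \<sigma> l \<Longrightarrow> t = replace_at s p (subst \<sigma> r) \<Longrightarrow>
    (s, t) \<in> rstep R"
  by (auto simp: rstep_def)

lemma rstep_rule: "(l, r) \<in> R \<Longrightarrow> (l, r) \<in> rstep R"
  by (rule rstepI[where p = "[]" and \<sigma> = Var]) auto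

lemma rstep_mono: "R \<subseteq> R' \<Longrightarrow> rstep R \<subseteq> rstep R'"
  unfolding rstep_def by blast

lemma rstep_Un: "rstep (R \<union> R') = rstep R \<union> rstep R'"
  unfolding rstep_def by blast

lemma rstep_converse: "rstep (R\<inverse>) = (rstep R)\<inverse>"
proof -
  have "(t, s) \<in> rstep R" if "(s, t) \<in> rstep (R\<inverse>)" for s t :: "('a, 'b) term" and R
  proof -
    from that obtain l r p \<sigma> where "(r, l) \<in> R" "p \<in> poss s" "subt_at s p = subst \<sigma> l"
      "t = replace_at s p (subst \<sigma> r)" by (auto simp: rstep_def)
    then show ?thesis by (intro rstepI[of r l R p t \<sigma>]) (auto, metis replace_at_subt_at)
  qed
  from this this[of _ _ "R\<inverse>"] show ?thesis by auto
qed

lemma stable_rstep: "stable (rstep R)"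
proof -
  have "(replace_at u q s, replace_at u q t) \<in> rstep R"
    if "(s, t) \<in> rstep R" "q \<in> poss u" for s t u :: "('a, 'b) term" and q
  proof -
    from that obtain l r p \<sigma> where "(l, r) \<in> R" "p \<in> poss s" "subt_at s p = subst \<sigma> l"
      "t = replace_at s p (subst \<sigma> r)" by (auto simp: rstep_def)
    then show ?thesis using that(2)
      by (intro rstepI[of l r R "q @ p" _ \<sigma>]) (auto simp: poss_append subt_at_append replace_at_below)
  qed
  moreover have "(subst \<tau> s, subst \<tau> t) \<in> rstep R" if "(s, t) \<in> rstep R" for s t \<tau>
  proof -
    from that obtain l r p \<sigma> where "(l, r) \<in> R" "p \<in> poss s" "subt_at s p = subst \<sigma> l"
      "t = replace_at s p (subst \<sigma> r)" by (auto simp: rstep_def)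
    then show ?thesis
      by (intro rstepI[of l r R p _ "subst_comp \<sigma> \<tau>"]) (auto simp: replace_at_subst subst_subst)
  qed
  ultimately show ?thesis unfolding stable_def by blast
qed

text \<open>A step is a rule put under a substitution and a context. As \<open>gt\<close>, AC
  conversion and the bounded conversions introduced later are all stable, inclusions between step
  relations thereby reduce to checking the rules.\<close>

lemma rstep_least:
  assumes "stable r" "R \<subseteq> r"
  shows "rstep R \<subseteq> r"
proof clarify
  fix s t assume "(s, t) \<in> rstep R"
  then obtain l r' p \<sigma> where *: "(l, r') \<in> R" "p \<in> poss s" "subt_at s p = subst \<sigma> l"
    "t = replace_at s p (subst \<sigma> r')" by (auto simp: rstep_def)
  then have "(replace_at s p (subst \<sigma> l), replace_at s p (subst \<sigma> r')) \<in> r"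
    using assms by (intro stable_ctxt stable_subst) auto
  then show "(s, t) \<in> r" using * by (metis replace_at_subt_at)
qed

lemma stable_sstep: "stable (sstep R)"
  unfolding sstep_def by (intro stable_Un stable_converse stable_rstep)

lemma stable_conv: "stable (conv R)"
  unfolding conv_def by (intro stable_rtrancl stable_sstep)

lemma stable_relmod: "stable (relmod R B)"
  unfolding relmod_def by (intro stable_relcomp stable_conv stable_rstep)

lemma sstep_eq_rstep_pm: "sstep B = rstep (pm B)"
  by (simp add: sstep_def pm_def rstep_Un rstep_converse)

lemma sstep_sym: "(s, t) \<in> sstep B \<Longrightarrow> (t, s) \<in> sstep B"
  by (auto simp: sstep_def)

lemma sstep_mono: "R \<subseteq> R' \<Longrightarrow> sstep R \<subseteq> sstep R'"
  using rstep_mono[of R R'] by (auto simp: sstep_def)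

lemma sstep_Un: "sstep (R \<union> R') = sstep R \<union> sstep R'"
  by (auto simp: sstep_def rstep_Un)

lemma conv_sym: "(s, t) \<in> conv B \<Longrightarrow> (t, s) \<in> conv B"
  unfolding conv_def by (metis converse_iff rtrancl_converse sstep_def converse_Un converse_converse Un_commute)

lemma conv_refl [simp]: "(s, s) \<in> conv B"
  by (simp add: conv_def)

lemma conv_trans: "(s, t) \<in> conv B \<Longrightarrow> (t, u) \<in> conv B \<Longrightarrow> (s, u) \<in> conv B"
  by (auto simp: conv_def)

lemma conv_mono: "R \<subseteq> R' \<Longrightarrow> conv R \<subseteq> conv R'"
  unfolding conv_def by (intro rtrancl_mono sstep_mono)

lemma rstep_conv: "(s, t) \<in> rstep R \<Longrightarrow> (s, t) \<in> conv R"
  by (auto simp: conv_def sstep_def)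

lemma conv_least:
  assumes "R \<subseteq> conv R'"
  shows "conv R \<subseteq> conv R'"
proof -
  have "rstep R \<subseteq> conv R'" using rstep_least[OF stable_conv assms] .
  then have "sstep R \<subseteq> conv R'" by (auto simp: sstep_def intro: conv_sym)
  then show ?thesis unfolding conv_def by (rule rtrancl_subset_rtrancl)
qed

lemma relmodI: "(s, s') \<in> conv B \<Longrightarrow> (s', t') \<in> rstep R \<Longrightarrow> (t', t) \<in> conv B \<Longrightarrow> (s, t) \<in> relmod R B"
  unfolding relmod_def by blast

lemma relmodE:
  assumes "(s, t) \<in> relmod R B"
  obtains s' t' where "(s, s') \<in> conv B" "(s', t') \<in> rstep R" "(t', t) \<in> conv B"
  using assms unfolding relmod_def by blast

lemma relmod_mono: "R \<subseteq> R' \<Longrightarrow> relmod R B \<subseteq> relmod R' B"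
  unfolding relmod_def using rstep_mono[of R R'] by blast

lemma relmod_conv: "(s, t) \<in> relmod R B \<Longrightarrow> (t, u) \<in> conv B \<Longrightarrow> (s, u) \<in> relmod R B"
  by (auto elim!: relmodE intro: relmodI conv_trans)

lemma relmod_subset_conv: "relmod R B \<subseteq> conv (R \<union> B)"
proof -
  have "conv B \<subseteq> conv (R \<union> B)" "rstep R \<subseteq> conv (R \<union> B)"
    using conv_mono[of B "R \<union> B"] conv_mono[of R "R \<union> B"] by (auto dest: rstep_conv)
  then show ?thesis unfolding relmod_def by (blast intro: conv_trans)
qed

lemma rtrancl_subst:
  assumes "stable r" "\<And>x. (\<sigma> x, \<tau> x) \<in> r\<^sup>*"
  shows "(subst \<sigma> t, subst \<tau> t) \<in> r\<^sup>*"
proof (induction t)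
  case (Fun f ts)
  \<comment> \<open>Arguments are switched from \<open>\<sigma>\<close> to \<open>\<tau>\<close> one
    at a time; in \<open>?us k\<close> the first \<open>k\<close> are done.\<close>
  let ?us = "\<lambda>k. map (subst \<tau>) (take k ts) @ map (subst \<sigma>) (drop k ts)"
  have "k \<le> length ts \<Longrightarrow> (Fun f (?us 0), Fun f (?us k)) \<in> r\<^sup>*" for k
  proof (induction k)
    case (Suc k)
    then have k: "k < length ts" by simp
    have us: "?us k = map (subst \<tau>) (take k ts) @ subst \<sigma> (ts ! k) # map (subst \<sigma>) (drop (Suc k) ts)"
      using k by (simp flip: Cons_nth_drop_Suc)
    have 1: "?us k = (?us k)[k := subst \<sigma> (ts ! k)]"
      using k unfolding us by (simp add: list_update_append)
    have 2: "?us (Suc k) = (?us k)[k := subst \<tau> (ts ! k)]"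
      using k unfolding us by (simp add: list_update_append take_Suc_conv_app_nth)
    have "(replace_at (Fun f (?us k)) [k] (subst \<sigma> (ts ! k)),
        replace_at (Fun f (?us k)) [k] (subst \<tau> (ts ! k))) \<in> r\<^sup>*"
      using k by (intro stable_ctxt[OF stable_rtrancl[OF assms(1)]] Fun.IH) auto
    then have "(Fun f (?us k), Fun f (?us (Suc k))) \<in> r\<^sup>*" using 1 2 by simp
    then show ?case using Suc by (meson Suc_leD rtrancl_trans)
  qed simp
  from this[of "length ts"] show ?case by simp
qed (use assms in simp)

section \<open>Steps at fixed positions: parallel, variable and critical overlaps\<close>

definition rstep_at :: "('f, 'v) trs \<Rightarrow> pos \<Rightarrow> ('f, 'v) term rel" where
  "rstep_at R p = {(s, t). \<exists>l r \<sigma>. (l, r) \<in> R \<and> p \<in> poss s \<and>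
      subt_at s p = subst \<sigma> l \<and> t = replace_at s p (subst \<sigma> r)}"

lemma rstep_at_rstep: "(s, t) \<in> rstep_at R p \<Longrightarrow> (s, t) \<in> rstep R"
  by (auto simp: rstep_at_def rstep_def)

lemma rstep_rstep_at: "(s, t) \<in> rstep R \<Longrightarrow> \<exists>p. (s, t) \<in> rstep_at R p"
  by (auto simp: rstep_at_def rstep_def)

lemma rstep_at_append:
  assumes "(s, t) \<in> rstep_at R (p @ q)"
  obtains t' where "p \<in> poss s" "(subt_at s p, t') \<in> rstep_at R q" "t = replace_at s p t'"
proof -
  from assms obtain l r \<sigma> where "(l, r) \<in> R" "p \<in> poss s" "q \<in> poss (subt_at s p)"
    "subt_at (subt_at s p) q = subst \<sigma> l"
    "t = replace_at s p (replace_at (subt_at s p) q (subst \<sigma> r))"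
    by (auto simp: rstep_at_def poss_append subt_at_append replace_at_append)
  then show thesis by (intro that) (auto simp: rstep_at_def)
qed

lemma rstep_at_below:
  assumes "(subt_at s p, t) \<in> rstep_at R q" "p \<in> poss s"
  shows "(s, replace_at s p t) \<in> rstep_at R (p @ q)"
  using assms unfolding rstep_at_def
  by (clarsimp simp: poss_append subt_at_append replace_at_append) metis

lemma parallel_rsteps_commute:
  assumes "(u, s) \<in> rstep_at R p" "(u, t) \<in> rstep_at S q"
    and "\<not> (\<exists>r. q = p @ r)" "\<not> (\<exists>r. p = q @ r)"
  obtains v where "(s, v) \<in> rstep S" "(t, v) \<in> rstep R"
proof -
  from assms(1) obtain l r \<sigma> where 1: "(l, r) \<in> R" "p \<in> poss u" "subt_at u p = subst \<sigma> l"
    "s = replace_at u p (subst \<sigma> r)" by (auto simp: rstep_at_def)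
  from assms(2) obtain l' r' \<tau> where 2: "(l', r') \<in> S" "q \<in> poss u" "subt_at u q = subst \<tau> l'"
    "t = replace_at u q (subst \<tau> r')" by (auto simp: rstep_at_def)
  note par = parallel_replace_at[OF 1(2) 2(2) assms(3,4), of "subst \<sigma> r" "subst \<tau> r'"]
    parallel_replace_at[OF 2(2) 1(2) assms(4,3), of "subst \<tau> r'" "subst \<sigma> r"]
  have "(s, replace_at s q (subst \<tau> r')) \<in> rstep S"
    using 1 2 par by (intro rstepI[of l' r' S q s \<tau>]) auto
  moreover have "(t, replace_at s q (subst \<tau> r')) \<in> rstep R"
    using 1 2 par by (intro rstepI[of l r R p t \<sigma>]) auto
  ultimately show thesis using that by blast
qed

text \<open>A position outside \<open>fun_poss l\<close> lies within the image of one variable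
  occurrence; as \<open>l\<close> is linear, the step rewrites just that image and the result is
  again an instance of \<open>l\<close>.\<close>

lemma variable_overlap:
  assumes "(subst \<sigma> l, s) \<in> rstep_at R q" "linear_term l" "q \<in> poss (subst \<sigma> l)" "q \<notin> fun_poss l"
  obtains \<tau> x where "s = subst \<tau> l" "x \<in> set (vars_list l)" "(\<sigma> x, \<tau> x) \<in> rstep R"
    "\<And>y. y \<noteq> x \<Longrightarrow> \<tau> y = \<sigma> y"
  using assms(3)
proof (cases rule: poss_subst_cases)
  case (var q1 q2 x)
  from assms(1) obtain l' r' \<rho> where *: "(l', r') \<in> R" "subt_at (subst \<sigma> l) q = subst \<rho> l'"
    "s = replace_at (subst \<sigma> l) q (subst \<rho> r')" by (auto simp: rstep_at_def)
  define \<tau> where "\<tau> = \<sigma>(x := replace_at (\<sigma> x) q2 (subst \<rho> r'))"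
  have "s = subst \<tau> l"
    using replace_at_linear_subst[OF assms(2) var(2,3)] * var by (simp add: \<tau>_def)
  moreover have "x \<in> set (vars_list l)" using poss_vars_list[OF var(2,3)] .
  moreover have "(\<sigma> x, \<tau> x) \<in> rstep R"
    using * var by (intro rstepI[of l' r' R q2 _ \<rho>]) (auto simp: \<tau>_def subt_at_append)
  ultimately show thesis by (rule that) (simp add: \<tau>_def)
qed (use assms in simp)

text \<open>Linearity gives exactly one step, where \<open>rtrancl_subst\<close> gives a number of
  steps that may be zero. AC equations are linear with the same variables on both sides, so in a
  cliff the term across the equation can really be rewritten.\<close>

lemma linear_subst_rstep:
  assumes "linear_term r" "x \<in> set (vars_list r)" "(\<sigma> x, \<tau> x) \<in> rstep R" "\<And>y. y \<noteq> x \<Longrightarrow> \<tau> y = \<sigma> y"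
  shows "(subst \<sigma> r, subst \<tau> r) \<in> rstep R"
proof -
  from vars_list_poss[OF assms(2)] obtain q where q: "q \<in> poss r" "subt_at r q = Var x" by blast
  have "\<tau> = \<sigma>(x := \<tau> x)" using assms(4) by auto
  then have "subst \<tau> r = replace_at (subst \<sigma> r) q (\<tau> x)"
    using replace_at_linear_subst[OF assms(1) q, of \<sigma> "[]" "\<tau> x"] by simp
  moreover have "subst \<sigma> r = replace_at (subst \<sigma> r) q (\<sigma> x)"
    using q by (metis poss_subst replace_at_subt_at subst.simps(1) subt_at_subst)
  ultimately show ?thesis
    using stable_ctxt[OF stable_rstep assms(3)] q by (metis poss_subst)
qed

text \<open>Overlaps are formed from rules without common variables, so the first rule is renamed
  apart and both substitutions are merged into one unifier, which factors through the mgu of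
  \<open>linear_mgu\<close>. Primality carries over to the mgu instance because a redex there would
  survive instantiation. The second outcome is the root overlap of variants, which does not count as
  critical.\<close>

lemma critical_overlap:
  fixes l1 :: "('f, 'v) term"
  assumes inf: "infinite (UNIV :: 'v set)"
    and R1: "(l1, r1) \<in> R1" and R2: "(l2, r2) \<in> R2"
    and lin: "linear_term l1" "linear_term l2"
    and p: "p \<in> fun_poss l2"
    and unif: "subst \<sigma>1 l1 = subst \<sigma>2 (subt_at l2 p)"
    and prime: "\<forall>q \<in> poss (subst \<sigma>1 l1). q \<noteq> [] \<longrightarrow> NF S (subt_at (subst \<sigma>1 l1) q)"
  obtains (pcp) a b \<delta> where "(a, b) \<in> PCP2 S R1 R2"
      "replace_at (subst \<sigma>2 l2) p (subst \<sigma>1 r1) = subst \<delta> a" "subst \<sigma>2 r2 = subst \<delta> b"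
  | (variant) "p = []" "variant (l1, r1) (l2, r2)"
proof -
  obtain \<pi> :: "'v \<Rightarrow> 'v" where \<pi>: "bij \<pi>" "\<pi> ` rule_vars (l1, r1) \<inter> rule_vars (l2, r2) = {}"
    using fresh_renaming[OF inf, of "rule_vars (l1, r1)" "rule_vars (l2, r2)"]
    by (auto simp: rule_vars_def)
  have pp: "p \<in> poss l2" using p by (auto simp: fun_poss_def)
  have vars: "vars_list (subst (Var \<circ> \<pi>) t) = map \<pi> (vars_list t)" for t :: "('f, 'v) term"
    by (induction t) (auto simp: map_concat comp_def intro!: arg_cong[where f = concat])
  let ?l = "subst (Var \<circ> \<pi>) l1" and ?r = "subst (Var \<circ> \<pi>) r1"
  have rv: "rule_vars (?l, ?r) = \<pi> ` rule_vars (l1, r1)"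
    by (auto simp: rule_vars_def vars)
  define \<tau> where "\<tau> x = (if x \<in> \<pi> ` rule_vars (l1, r1) then \<sigma>1 (inv \<pi> x) else \<sigma>2 x)" for x
  have \<tau>1: "subst \<tau> (subst (Var \<circ> \<pi>) t) = subst \<sigma>1 t"
    if "set (vars_list t) \<subseteq> rule_vars (l1, r1)" for t
    using that \<pi>(1) unfolding subst_subst subst_cong_iff
    by (auto simp: subst_comp_def \<tau>_def bij_is_inj)
  have \<tau>2: "subst \<tau> t = subst \<sigma>2 t" if "set (vars_list t) \<subseteq> rule_vars (l2, r2)" for t
    using that \<pi>(2) unfolding subst_cong_iff by (auto simp: \<tau>_def)
  have l: "subst \<tau> ?l = subst \<sigma>1 l1" and r: "subst \<tau> ?r = subst \<sigma>1 r1"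
    by (auto intro!: \<tau>1 simp: rule_vars_def)
  have l2: "subst \<tau> l2 = subst \<sigma>2 l2" and r2: "subst \<tau> r2 = subst \<sigma>2 r2"
    by (auto intro!: \<tau>2 simp: rule_vars_def)
  have sub: "subst \<tau> (subt_at l2 p) = subst \<sigma>2 (subt_at l2 p)"
    using l2 pp by (metis subt_at_subst)
  have vs: "set (vars_list (subt_at l2 p)) \<subseteq> set (vars_list l2)"
  proof
    fix x assume "x \<in> set (vars_list (subt_at l2 p))"
    from vars_list_poss[OF this]
    obtain q where "q \<in> poss (subt_at l2 p)" "subt_at (subt_at l2 p) q = Var x" ..
    then show "x \<in> set (vars_list l2)"
      using poss_vars_list[of "p @ q" l2 x] pp by (simp add: poss_append subt_at_append)
  qed
  have linl: "linear_term ?l" using lin(1) \<pi>(1)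
    by (auto simp: linear_term_def vars distinct_map bij_def inj_on_def)
  have disj: "set (vars_list ?l) \<inter> set (vars_list (subt_at l2 p)) = {}"
    using \<pi>(2) vs by (auto simp: rule_vars_def vars)
  have \<tau>u: "subst \<tau> ?l = subst \<tau> (subt_at l2 p)" using l sub unif by simp
  from linear_mgu[OF linl linear_subt_at[OF lin(2) pp] disj \<tau>u] obtain \<sigma> where
    \<sigma>: "subst \<sigma> ?l = subst \<sigma> (subt_at l2 p)"
    "\<And>\<tau> x. subst \<tau> ?l = subst \<tau> (subt_at l2 p) \<Longrightarrow> subst \<tau> (\<sigma> x) = \<tau> x" by blast
  have mgu: "is_mgu \<sigma> ?l (subt_at l2 p)"
    unfolding is_mgu_def subst_comp_def
  proof (intro conjI allI impI)
    fix \<tau> assume "subst \<tau> ?l = subst \<tau> (subt_at l2 p)"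
    then show "\<exists>\<delta>. \<tau> = (\<lambda>x. subst \<delta> (\<sigma> x))" using \<sigma>(2) by (intro exI[of _ \<tau>] ext) simp
  qed (rule \<sigma>(1))
  have comp: "subst \<tau> (subst \<sigma> t) = subst \<tau> t" for t
    unfolding subst_subst subst_cong_iff subst_comp_def using \<sigma>(2)[OF \<tau>u] by simp
  show thesis
  proof (cases "p = [] \<and> Defs.variant (?l, ?r) (l2, r2)")
    case True
    then obtain \<rho> where \<rho>: "bij \<rho>" "?l = subst (Var \<circ> \<rho>) l2" "?r = subst (Var \<circ> \<rho>) r2"
      by (auto simp: variant_def renaming_def)
    have inv: "subst (Var \<circ> inv \<pi>) (subst (Var \<circ> \<pi>) t) = t" for t :: "('f, 'v) term"
    proof -
      have "subst_comp (Var \<circ> \<pi>) (Var \<circ> inv \<pi>) = (Var :: 'v \<Rightarrow> ('f, 'v) term)"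
        using \<pi>(1) by (auto simp: subst_comp_def bij_is_inj)
      then show ?thesis by (simp add: subst_subst)
    qed
    have c: "subst_comp (Var \<circ> \<rho>) (Var \<circ> inv \<pi>) = Var \<circ> (inv \<pi> \<circ> \<rho>)"
      by (auto simp: subst_comp_def)
    have "l1 = subst (Var \<circ> (inv \<pi> \<circ> \<rho>)) l2" "r1 = subst (Var \<circ> (inv \<pi> \<circ> \<rho>)) r2"
      using inv[of l1] inv[of r1] \<rho>(2,3) by (simp_all add: subst_subst c)
    moreover have "bij (inv \<pi> \<circ> \<rho>)" using \<pi>(1) \<rho>(1) by (simp add: bij_comp bij_imp_bij_inv)
    ultimately have "Defs.variant (l1, r1) (l2, r2)"
      unfolding variant_def renaming_def by auto
    then show thesis using True variant by blast
  next
    case False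
    have ov: "overlap R1 R2 (?l, ?r) p (l2, r2)"
    proof -
      have "Defs.variant (?l, ?r) (l1, r1)" using \<pi>(1) by (auto simp: variant_def renaming_def)
      moreover have "Defs.variant (l2, r2) (l2, r2)"
        unfolding variant_def renaming_def by (intro exI[of _ id]) auto
      ultimately show ?thesis
        unfolding overlap_def using R1 R2 rv \<pi>(2) p \<tau>u False by auto
    qed
    have eq: "subst \<tau> (subst \<sigma> (subt_at l2 p)) = subst \<sigma>1 l1" using comp \<tau>u l by simp
    have pr: "\<forall>q \<in> poss (subt_at (subst \<sigma> l2) p). q \<noteq> [] \<longrightarrow>
      NF S (subt_at (subt_at (subst \<sigma> l2) p) q)"
    proof (intro ballI impI)
      fix q assume q: "q \<in> poss (subt_at (subst \<sigma> l2) p)" "q \<noteq> []"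
      then have q': "q \<in> poss (subst \<sigma> (subt_at l2 p))" using pp by simp
      then have "q \<in> poss (subst \<sigma>1 l1)" using eq by (metis poss_subst)
      then have nf: "NF S (subt_at (subst \<sigma>1 l1) q)" using prime q(2) by blast
      have "subt_at (subst \<sigma>1 l1) q = subst \<tau> (subt_at (subst \<sigma> (subt_at l2 p)) q)"
        using eq q' by (metis subt_at_subst)
      then show "NF S (subt_at (subt_at (subst \<sigma> l2) p) q)"
        using nf stable_subst[OF stable_rstep] pp unfolding NF_def by (metis subt_at_subst)
    qed
    have "(replace_at (subst \<sigma> l2) p (subst \<sigma> ?r), subst \<sigma> r2) \<in> PCP2 S R1 R2"
      unfolding PCP2_def using ov mgu pr by blast
    moreover have "replace_at (subst \<sigma>2 l2) p (subst \<sigma>1 r1) =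
      subst \<tau> (replace_at (subst \<sigma> l2) p (subst \<sigma> ?r))"
      using pp l2 r comp by (simp add: replace_at_subst)
    moreover have "subst \<sigma>2 r2 = subst \<tau> (subst \<sigma> r2)" using r2 comp by simp
    ultimately show thesis using pcp by blast
  qed
qed

section \<open>Bounded conversions\<close>

text \<open>The empty conversion is available at every term, even outside \<open>W\<close>; hence
  \<open>conv_within_closed\<close> asks for a start in \<open>W\<close>.\<close>

definition conv_within :: "'a rel \<Rightarrow> 'a set \<Rightarrow> 'a rel" where
  "conv_within r W = {(x, y). (x, y) \<in> r \<and> x \<in> W \<and> y \<in> W}\<^sup>*"

lemma conv_within_refl [simp]: "(x, x) \<in> conv_within r W"
  by (simp add: conv_within_def)

lemma conv_within_step: "(x, y) \<in> r \<Longrightarrow> x \<in> W \<Longrightarrow> y \<in> W \<Longrightarrow> (x, y) \<in> conv_within r W"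
  by (auto simp: conv_within_def)

lemma conv_within_trans:
  "(x, y) \<in> conv_within r W \<Longrightarrow> (y, z) \<in> conv_within r W \<Longrightarrow> (x, z) \<in> conv_within r W"
  by (auto simp: conv_within_def)

lemma conv_within_sym:
  assumes "sym r" "(x, y) \<in> conv_within r W"
  shows "(y, x) \<in> conv_within r W"
proof -
  have "sym {(x, y). (x, y) \<in> r \<and> x \<in> W \<and> y \<in> W}" using assms(1) by (auto simp: sym_def)
  then show ?thesis using assms(2) unfolding conv_within_def by (rule symD[OF sym_rtrancl])
qed

lemma conv_within_mono: "W \<subseteq> W' \<Longrightarrow> (x, y) \<in> conv_within r W \<Longrightarrow> (x, y) \<in> conv_within r W'"
  unfolding conv_within_def by (rule subsetD[OF rtrancl_mono]) auto

lemma conv_within_closed: "(x, y) \<in> conv_within r W \<Longrightarrow> x \<in> W \<Longrightarrow> y \<in> W"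
  unfolding conv_within_def by (induction rule: rtrancl_induct) auto

lemma conv_within_image:
  assumes "(x, y) \<in> conv_within r {x. f x \<in> W}" "\<And>x y. (x, y) \<in> r \<Longrightarrow> (f x, f y) \<in> r"
  shows "(f x, f y) \<in> conv_within r W"
  using assms(1) unfolding conv_within_def
  by (induction rule: rtrancl_induct) (auto intro: rtrancl_into_rtrancl assms(2))

text \<open>The induction claim \<open>A u\<close> concerns the whole \<open>b\<close>-class of
  \<open>u\<close>, because a cliff leads to a term that is equivalent to \<open>u\<close> but not
  smaller. Compatibility puts everything below some member of the class also below \<open>u\<close>,
  so the induction hypothesis covers all terms of the conversions given by \<open>peak\<close> and
  \<open>cliff\<close>, and \<open>conv_nf\<close> compares normal forms along them.\<close>

lemma church_rosser_modulo:
  fixes r b gt :: "'a rel"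
  assumes wf: "wf (gt\<inverse>)" and rgt: "r \<subseteq> gt" and sym: "sym b"
    and compat: "b\<^sup>* O gt O b\<^sup>* \<subseteq> gt"
    and peak: "\<And>u s t. (u, s) \<in> r \<Longrightarrow> (u, t) \<in> r \<Longrightarrow>
      (s, t) \<in> conv_within (r \<union> r\<inverse> \<union> b) {x. (u, x) \<in> gt}"
    and cliff: "\<And>u s t. (u, s) \<in> r \<Longrightarrow> (u, t) \<in> b \<Longrightarrow>
      \<exists>t'. (t, t') \<in> r \<and> (t', s) \<in> conv_within (r \<union> r\<inverse> \<union> b) {x. (u, x) \<in> gt}"
  shows "(r \<union> r\<inverse> \<union> b)\<^sup>* \<subseteq> r\<^sup>* O b\<^sup>* O (r\<inverse>)\<^sup>*"
proof -
  let ?c = "conv_within (r \<union> r\<inverse> \<union> b)"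
  define nf where "nf x y \<longleftrightarrow> (x, y) \<in> r\<^sup>* \<and> y \<notin> Domain r" for x y
  define A where "A u \<longleftrightarrow> (\<forall>v x y. (u, v) \<in> b\<^sup>* \<longrightarrow> nf u x \<longrightarrow> nf v y \<longrightarrow> (x, y) \<in> b\<^sup>*)" for u
  have symb: "(x, y) \<in> b\<^sup>* \<Longrightarrow> (y, x) \<in> b\<^sup>*" for x y
    by (rule symD[OF sym_rtrancl[OF sym]])
  have ex_nf: "\<exists>y. nf x y" for x
    using wf
  proof (induction x rule: wf_induct_rule)
    case (less x)
    show ?case
    proof (cases "x \<in> Domain r")
      case True
      then obtain z where z: "(x, z) \<in> r" by blast
      then obtain y where "nf z y" using less rgt by blast
      then show ?thesis using z by (auto simp: nf_def intro: converse_rtrancl_into_rtrancl)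
    qed (auto simp: nf_def)
  qed
  have nf_step: "nf x z" if "(x, y) \<in> r" "nf y z" for x y z
    using that by (auto simp: nf_def intro: converse_rtrancl_into_rtrancl)
  have conv_nf: "\<forall>x y. nf w x \<longrightarrow> nf w' y \<longrightarrow> (x, y) \<in> b\<^sup>*"
    if "(w, w') \<in> ?c W" "w \<in> W" "\<And>v. v \<in> W \<Longrightarrow> A v" for w w' W
    using that(1) unfolding conv_within_def
  proof (induction rule: rtrancl_induct)
    case base
    then show ?case using that(2,3) unfolding A_def by blast
  next
    case (step v z)
    then have vz: "(v, z) \<in> r \<union> r\<inverse> \<union> b" "A v" "A z" using that(3) by auto
    have "(x', y) \<in> b\<^sup>*" if "nf v x'" "nf z y" for x' y
    proof -
      consider "(v, z) \<in> r" | "(z, v) \<in> r" | "(v, z) \<in> b" using vz by blast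
      then show ?thesis
      proof cases
        case 1
        then have "nf v y" using nf_step that by blast
        then show ?thesis using vz that unfolding A_def by blast
      next
        case 2
        then have "nf z x'" using nf_step that by blast
        then show ?thesis using vz that unfolding A_def by blast
      next
        case 3
        then show ?thesis using vz that unfolding A_def by blast
      qed
    qed
    then show ?case using step.IH ex_nf[of v] by (meson rtrancl_trans)
  qed
  have A: "A u" for u
    using wf
  proof (induction u rule: wf_induct_rule)
    case (less u)
    have below: "(u, x) \<in> gt" if "(u, v) \<in> b\<^sup>*" "(v, x) \<in> gt" for v x
      using that compat by blast
    have IH: "(x, y) \<in> b\<^sup>*"
      if "(u, v) \<in> b\<^sup>*" "(s, t) \<in> ?c {x. (v, x) \<in> gt}" "(v, s) \<in> gt" "nf s x" "nf t y" for v s t x y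
      using conv_nf[OF that(2)] that below less by blast
    have same: "(x, y) \<in> b\<^sup>*" if v: "(u, v) \<in> b\<^sup>*" and x: "nf v x" and y: "nf v y" for v x y
    proof (cases "v \<in> Domain r")
      case True
      then have "v \<noteq> x" "v \<noteq> y" using x y by (auto simp: nf_def)
      then obtain x1 y1 where "(v, x1) \<in> r" "nf x1 x" "(v, y1) \<in> r" "nf y1 y"
        using x y unfolding nf_def by (metis converse_rtranclE)
      then show ?thesis using IH[OF v peak] rgt by blast
    next
      case False
      then show ?thesis using x y unfolding nf_def by (metis Domain.DomainI converse_rtranclE rtrancl.rtrancl_refl)
    qed
    \<comment> \<open>If \<open>v\<close> is reducible, \<open>cliff\<close> makes \<open>v'\<close>
      reducible as well. The chain runs from \<open>x\<close> to a normal form \<open>a\<close> of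
      \<open>s\<close>, on to a normal form \<open>c\<close> of \<open>t\<close>, and from there to
      \<open>y\<close>; the middle link uses the conversion of the cliff, the outer ones are peaks
      (\<open>same\<close>).\<close>
    have half: "(x, y) \<in> b\<^sup>*"
      if v: "(u, v) \<in> b\<^sup>*" "(v, v') \<in> b" and x: "nf v x" and y: "nf v' y" and d: "v \<in> Domain r"
      for v v' x y
    proof -
      from d obtain s where s: "(v, s) \<in> r" by blast
      from cliff[OF s v(2)] obtain t where t: "(v', t) \<in> r" "(t, s) \<in> ?c {x. (v, x) \<in> gt}" by blast
      obtain a where a: "nf s a" using ex_nf by blast
      obtain c where c: "nf t c" using ex_nf by blast
      have v': "(u, v') \<in> b\<^sup>*" using v by auto
      have "(v', v) \<in> b\<^sup>*" using v(2) symb by blast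
      then have "(v, t) \<in> gt" using t(1) rgt compat symb by blast
      then have "(c, a) \<in> b\<^sup>*" using IH[OF v(1) t(2)] c a by blast
      moreover have "(x, a) \<in> b\<^sup>*" using same[OF v(1) x] nf_step[OF s a] by blast
      moreover have "(c, y) \<in> b\<^sup>*" using same[OF v' nf_step[OF t(1) c] y] .
      ultimately show ?thesis using symb by (meson rtrancl_trans)
    qed
    have adj: "(x, y) \<in> b\<^sup>*"
      if v: "(u, v) \<in> b\<^sup>*" "(v, v') \<in> b" and x: "nf v x" and y: "nf v' y" for v v' x y
    proof -
      have v': "(u, v') \<in> b\<^sup>*" "(v', v) \<in> b" using v sym by (auto simp: sym_def)
      consider "v \<in> Domain r" | "v' \<in> Domain r" | "v \<notin> Domain r" "v' \<notin> Domain r" by blast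
      then show ?thesis
      proof cases
        case 1
        then show ?thesis using half[OF v x y] by blast
      next
        case 2
        then show ?thesis using half[OF v' y x] symb by blast
      next
        case 3
        then have "x = v" "y = v'" using x y unfolding nf_def
          by (metis Domain.DomainI converse_rtranclE)+
        then show ?thesis using v by blast
      qed
    qed
    have "\<forall>x y. nf u x \<longrightarrow> nf v y \<longrightarrow> (x, y) \<in> b\<^sup>*" if "(u, v) \<in> b\<^sup>*" for v
      using that
    proof (induction rule: rtrancl_induct)
      case base
      then show ?case using same by blast
    next
      case (step v v')
      then show ?case using adj[OF step(1,2)] ex_nf[of v] by (meson rtrancl_trans)
    qed
    then show ?case unfolding A_def by blast
  qed
  show ?thesis
  proof clarify
    fix s t assume "(s, t) \<in> (r \<union> r\<inverse> \<union> b)\<^sup>*"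
    then have st: "(s, t) \<in> ?c UNIV" unfolding conv_within_def
      by (rule subsetD[OF rtrancl_mono, rotated]) auto
    obtain x y where "nf s x" "nf t y" using ex_nf by blast
    moreover then have "(x, y) \<in> b\<^sup>*" using conv_nf[OF st] A by blast
    ultimately show "(s, t) \<in> r\<^sup>* O b\<^sup>* O (r\<inverse>)\<^sup>*"
      unfolding nf_def by (meson relcomp.relcompI rtrancl_converseI)
  qed
qed

section \<open>Innermost redexes and primality\<close>

definition innermost_at :: "('f, 'v) trs \<Rightarrow> ('f, 'v) term \<Rightarrow> pos \<Rightarrow> bool" where
  "innermost_at R u p \<longleftrightarrow>
    (\<forall>q \<in> poss (subt_at u p). q \<noteq> [] \<longrightarrow> NF R (subt_at (subt_at u p) q))"

lemma innermost_at_append: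
  "p \<in> poss u \<Longrightarrow> innermost_at R u (p @ q) \<longleftrightarrow> innermost_at R (subt_at u p) q"
  by (simp add: innermost_at_def subt_at_append)

lemma size_subt_at: "p \<in> poss t \<Longrightarrow> p \<noteq> [] \<Longrightarrow> size (subt_at t p) < size t"
proof (induction t p rule: subt_at.induct)
  case (2 f ts i p)
  then have "size (ts ! i) < size (Fun f ts)"
    by (auto simp: less_Suc_eq_le intro: size_list_estimation'[OF nth_mem])
  moreover have "size (subt_at (ts ! i) p) \<le> size (ts ! i)"
    using 2 by (cases "p = []") auto
  ultimately show ?case by simp
qed auto

lemma innermost_redex:
  "\<not> NF R v \<Longrightarrow> \<exists>q w. (v, w) \<in> rstep_at R q \<and> innermost_at R v q"
proof (induction v rule: measure_induct_rule[where f = size])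
  case (less v)
  then obtain q w where qw: "(v, w) \<in> rstep_at R q" by (auto simp: NF_def dest: rstep_rstep_at)
  then have q: "q \<in> poss v" by (auto simp: rstep_at_def)
  show ?case
  proof (cases "innermost_at R v q")
    case False
    then obtain q' where q': "q' \<in> poss (subt_at v q)" "q' \<noteq> []" "\<not> NF R (subt_at v (q @ q'))"
      using q by (auto simp: innermost_at_def subt_at_append)
    then have qq: "q @ q' \<in> poss v" using q by (simp add: poss_append)
    from less.IH[OF size_subt_at[OF qq] q'(3)] q' obtain p w where
      "(subt_at v (q @ q'), w) \<in> rstep_at R p" "innermost_at R (subt_at v (q @ q')) p" by auto
    then have "(v, replace_at v (q @ q') w) \<in> rstep_at R ((q @ q') @ p)"
      "innermost_at R v ((q @ q') @ p)"
      using qq rstep_at_below innermost_at_append by blast+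
    then show ?thesis by blast
  qed (use qw in blast)
qed

lemma innermost_below:
  assumes "p \<in> poss u" "\<not> innermost_at R u p"
  obtains q w where "(u, w) \<in> rstep_at R (p @ q)" "innermost_at R u (p @ q)"
proof -
  from assms obtain q where q: "q \<in> poss (subt_at u p)" "\<not> NF R (subt_at u (p @ q))"
    by (auto simp: innermost_at_def subt_at_append)
  then have pq: "p @ q \<in> poss u" using assms(1) by (simp add: poss_append)
  from innermost_redex[OF q(2)] obtain q' w where
    "(subt_at u (p @ q), w) \<in> rstep_at R q'" "innermost_at R (subt_at u (p @ q)) q'" by blast
  then have "(u, replace_at u (p @ q) w) \<in> rstep_at R ((p @ q) @ q')"
    "innermost_at R u ((p @ q) @ q')"
    using pq rstep_at_below innermost_at_append by blast+
  then show thesis using that by simp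
qed

lemma pm_AC_linear:
  assumes "(l, r) \<in> pm (AC F)"
  shows "linear_term l" "linear_term r" "set (vars_list r) = set (vars_list l)"
  using assms by (auto simp: pm_def AC_def linear_term_def)

lemma pm_conv: "(l, r) \<in> pm B \<Longrightarrow> (l, r) \<in> conv B"
  by (metis conv_def r_into_rtrancl rstep_rule sstep_eq_rstep_pm)

lemma join_mod_sym: "(s, t) \<in> join_mod R B \<Longrightarrow> (t, s) \<in> join_mod R B"
  unfolding join_mod_def by (auto simp: rtrancl_converse intro: conv_sym)

lemma stable_join_mod: "stable (join_mod R B)"
  unfolding join_mod_def
  by (intro stable_relcomp stable_rtrancl stable_converse stable_rstep stable_conv)

section \<open>AC-compatible reduction orders and the conversions they bound\<close>

locale ac_reduction_order =
  fixes F :: "'f set" and gt :: "('f, 'v) term rel"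
  assumes infinite_vars: "infinite (UNIV :: 'v set)"
    and reduction_order: "reduction_order_mod (AC F) gt"
begin

lemma gt_irrefl: "(s, s) \<notin> gt"
  using reduction_order by (auto simp: reduction_order_mod_def irrefl_def)

lemma gt_trans: "(s, t) \<in> gt \<Longrightarrow> (t, u) \<in> gt \<Longrightarrow> (s, u) \<in> gt"
  using reduction_order by (auto simp: reduction_order_mod_def dest: transD)

lemma gt_wf: "wf (gt\<inverse>)"
  using reduction_order by (auto simp: reduction_order_mod_def)

lemma gt_stable: "stable gt"
  using reduction_order unfolding reduction_order_mod_def stable_def by blast

lemma gt_compat: "conv (AC F) O gt O conv (AC F) \<subseteq> gt"
  using reduction_order unfolding reduction_order_mod_def by blast

lemma conv_gt: "(s, t) \<in> conv (AC F) \<Longrightarrow> (t, u) \<in> gt \<Longrightarrow> (s, u) \<in> gt"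
  using conv_refl[of u "AC F"] by (intro subsetD[OF gt_compat]) blast

lemma gt_conv: "(s, t) \<in> gt \<Longrightarrow> (t, u) \<in> conv (AC F) \<Longrightarrow> (s, u) \<in> gt"
  using conv_refl[of s "AC F"] by (intro subsetD[OF gt_compat]) blast

lemma gt_not_conv: "(s, t) \<in> gt \<Longrightarrow> (s, t) \<notin> conv (AC F)"
  using gt_conv conv_sym gt_irrefl by blast

lemma rstep_gt: "R \<subseteq> gt \<Longrightarrow> rstep R \<subseteq> gt"
  by (rule rstep_least[OF gt_stable])

lemma relmod_gt: "R \<subseteq> gt \<Longrightarrow> relmod R (AC F) \<subseteq> gt"
  using rstep_gt[of R] gt_compat unfolding relmod_def by blast

text \<open>A variable \<open>x\<close> of \<open>r\<close> missing in \<open>l\<close> could be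
  instantiated by \<open>l\<close> itself. This puts \<open>l\<close> above a term \<open>v\<close>
  that contains \<open>l\<close> as a subterm, and iterating the surrounding context descends
  forever.\<close>

lemma gt_vars:
  assumes "(l, r) \<in> gt"
  shows "set (vars_list r) \<subseteq> set (vars_list l)"
proof (rule ccontr)
  assume "\<not> ?thesis"
  then obtain x where x: "x \<in> set (vars_list r)" "x \<notin> set (vars_list l)" by blast
  then obtain p where p: "p \<in> poss r" "subt_at r p = Var x" using vars_list_poss[OF x(1)] by blast
  define v where "v = subst (Var(x := l)) r"
  have "subst (Var(x := l)) l = subst Var l" using x(2) by (subst subst_cong_iff) auto
  then have lv: "(l, v) \<in> gt" using stable_subst[OF gt_stable assms, of "Var(x := l)"] by (simp add: v_def)
  have pv: "p \<in> poss v" "subt_at v p = l" using p by (simp_all add: v_def)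
  define h where "h k = (replace_at v p ^^ k) l" for k
  have "(h k, h (Suc k)) \<in> gt" for k
  proof (induction k)
    case 0
    then show ?case using lv pv replace_at_subt_at[OF pv(1)] by (simp add: h_def)
  next
    case (Suc k)
    then show ?case using stable_ctxt[OF gt_stable Suc pv(1)] by (simp add: h_def)
  qed
  then show False using gt_wf unfolding wf_iff_no_infinite_down_chain by auto
qed

definition down_closed :: "('f, 'v) term set \<Rightarrow> bool" where
  "down_closed W \<longleftrightarrow> (\<forall>x y. x \<in> W \<longrightarrow> (x, y) \<in> gt \<union> conv (AC F) \<longrightarrow> y \<in> W)"

abbreviation below :: "('f, 'v) term \<Rightarrow> ('f, 'v) term set" where
  "below u \<equiv> {x. (u, x) \<in> gt}"

lemma down_closed_below: "down_closed (below u)"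
  unfolding down_closed_def by (auto intro: gt_trans gt_conv)

lemma below_conv: "(u, v) \<in> conv (AC F) \<Longrightarrow> below u = below v"
  by (auto intro: conv_gt conv_sym)

lemma below_subset: "down_closed W \<Longrightarrow> u \<in> W \<Longrightarrow> below u \<subseteq> W"
  unfolding down_closed_def by blast

abbreviation cv :: "('f, 'v) trs \<Rightarrow> ('f, 'v) term set \<Rightarrow> ('f, 'v) term rel" where
  "cv R \<equiv> conv_within (sstep (R \<union> AC F))"

lemma cv_sym: "(x, y) \<in> cv R W \<Longrightarrow> (y, x) \<in> cv R W"
  by (rule conv_within_sym) (auto simp: sym_def intro: sstep_sym)

lemma cv_rsteps:
  assumes "(x, y) \<in> (rstep R)\<^sup>*" "R \<subseteq> gt" "down_closed W" "x \<in> W"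
  shows "y \<in> W \<and> (x, y) \<in> cv R W"
  using assms(1)
proof (induction rule: rtrancl_induct)
  case (step y z)
  then have "z \<in> W" using rstep_gt[OF assms(2)] assms(3) unfolding down_closed_def by blast
  moreover have "(y, z) \<in> sstep (R \<union> AC F)" using step(2) by (auto simp: sstep_def rstep_Un)
  ultimately show ?case using step(3) by (auto intro: conv_within_trans conv_within_step)
qed (use assms in simp)

lemma cv_conv:
  assumes "(x, y) \<in> conv (AC F)" "down_closed W" "x \<in> W"
  shows "y \<in> W \<and> (x, y) \<in> cv R W"
  using assms(1) unfolding conv_def
proof (induction rule: rtrancl_induct)
  case (step y z)
  then have "(y, z) \<in> conv (AC F)" by (auto simp: conv_def)
  then have "z \<in> W" using step(3) assms(2) unfolding down_closed_def by blast
  moreover have "(y, z) \<in> sstep (R \<union> AC F)" using step(2) by (auto simp: sstep_Un)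
  ultimately show ?case using step(3) by (auto intro: conv_within_trans conv_within_step)
qed (use assms in simp)

text \<open>Closure under contexts and substitutions is where quantifying over \<^emph>\<open>all\<close> down-closed sets
  pays off: the preimage of a down-closed set under a context or a substitution is down-closed.\<close>

definition bounded_conv :: "('f, 'v) trs \<Rightarrow> ('f, 'v) term rel" where
  "bounded_conv R = {(s, t). \<forall>W. down_closed W \<longrightarrow> s \<in> W \<longrightarrow> t \<in> W \<longrightarrow> (s, t) \<in> cv R W}"

text \<open>The source alone serves as bound: its first step already leads strictly below it. A
  bounded conversion has no such distinguished end and is limited by both.\<close>

definition head_conv :: "('f, 'v) trs \<Rightarrow> ('f, 'v) term rel" where
  "head_conv R = {(s, t). \<exists>u. (s, u) \<in> rstep R \<and> (u, t) \<in> cv R (below s)}"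

lemma stable_bounded_conv: "stable (bounded_conv R)"
proof -
  have *: "(f s, f t) \<in> bounded_conv R"
    if "(s, t) \<in> bounded_conv R" and f: "\<And>r x y. stable r \<Longrightarrow> (x, y) \<in> r \<Longrightarrow> (f x, f y) \<in> r"
    for s t f
  proof -
    have "(f s, f t) \<in> cv R W" if W: "down_closed W" "f s \<in> W" "f t \<in> W" for W
    proof -
      have "down_closed {x. f x \<in> W}"
        using W(1) f[OF gt_stable] f[OF stable_conv] unfolding down_closed_def by blast
      then have "(s, t) \<in> cv R {x. f x \<in> W}"
        using \<open>(s, t) \<in> bounded_conv R\<close> W unfolding bounded_conv_def by blast
      then show ?thesis by (rule conv_within_image) (rule f[OF stable_sstep])
    qed
    then show ?thesis unfolding bounded_conv_def by blast
  qed
  show ?thesis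
    unfolding stable_def by (blast intro: * stable_ctxt stable_subst)
qed

lemma stable_head_conv: "stable (head_conv R)"
proof -
  have *: "(f s, f t) \<in> head_conv R"
    if "(s, t) \<in> head_conv R" and f: "\<And>r x y. stable r \<Longrightarrow> (x, y) \<in> r \<Longrightarrow> (f x, f y) \<in> r"
    for s t f
  proof -
    from that(1) obtain u where u: "(s, u) \<in> rstep R" "(u, t) \<in> cv R (below s)"
      by (auto simp: head_conv_def)
    have "below s \<subseteq> {x. f x \<in> below (f s)}" using f[OF gt_stable] by blast
    then have "(f u, f t) \<in> cv R (below (f s))"
      using u(2) by (intro conv_within_image[OF _ f[OF stable_sstep]]) (rule conv_within_mono)
    then show ?thesis using f[OF stable_rstep u(1)] by (auto simp: head_conv_def)
  qed
  show ?thesis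
    unfolding stable_def by (blast intro: * stable_ctxt stable_subst)
qed

lemma bounded_conv_sym: "(s, t) \<in> bounded_conv R \<Longrightarrow> (t, s) \<in> bounded_conv R"
  unfolding bounded_conv_def by (blast intro: cv_sym)

lemma head_conv_cv:
  assumes "(s, t) \<in> head_conv R" "R \<subseteq> gt" "down_closed W" "s \<in> W"
  shows "t \<in> W \<and> (s, t) \<in> cv R W"
proof -
  from assms(1) obtain u where u: "(s, u) \<in> rstep R" "(u, t) \<in> cv R (below s)"
    by (auto simp: head_conv_def)
  have "u \<in> below s" using u(1) rstep_gt[OF assms(2)] by blast
  then have "t \<in> W" using conv_within_closed[OF u(2)] below_subset[OF assms(3,4)] by blast
  moreover have "(u, t) \<in> cv R W" using conv_within_mono[OF below_subset[OF assms(3,4)] u(2)] .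
  moreover have "(s, u) \<in> cv R W" using cv_rsteps[of s u R W] u(1) assms by blast
  ultimately show ?thesis by (blast intro: conv_within_trans)
qed

lemma head_conv_bounded: "R \<subseteq> gt \<Longrightarrow> head_conv R \<subseteq> bounded_conv R"
  using head_conv_cv unfolding bounded_conv_def by blast

lemma head_conv_gt: "R \<subseteq> gt \<Longrightarrow> head_conv R \<subseteq> gt"
  using rstep_gt[of R] unfolding head_conv_def by (blast dest: conv_within_closed)

lemma head_conv_relmod:
  assumes "(s, t) \<in> relmod R' (AC F)" "R' \<subseteq> head_conv R" "R \<subseteq> gt" "down_closed W" "s \<in> W"
  shows "t \<in> W \<and> (s, t) \<in> cv R W"
proof -
  from assms(1) obtain s' t' where *: "(s, s') \<in> conv (AC F)" "(s', t') \<in> rstep R'"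
    "(t', t) \<in> conv (AC F)" by (rule relmodE)
  have 1: "s' \<in> W \<and> (s, s') \<in> cv R W" using cv_conv[OF *(1) assms(4,5)] .
  have "(s', t') \<in> head_conv R" using *(2) rstep_least[OF stable_head_conv assms(2)] by blast
  then have 2: "t' \<in> W \<and> (s', t') \<in> cv R W" using head_conv_cv assms(3,4) 1 by blast
  have "t \<in> W \<and> (t', t) \<in> cv R W" using cv_conv[OF *(3) assms(4)] 2 by blast
  then show ?thesis using 1 2 by (blast intro: conv_within_trans)
qed

text \<open>Glues a cliff closed at an innermost redex, with contractum \<open>w\<close>, to the
  peak between \<open>w\<close> and the given \<open>s\<close>. AC-equivalent terms have the same
  terms below them, so both conversions respect the same bound.\<close>

lemma head_conv_trans:
  assumes "(t, w) \<in> head_conv R" "(w, s) \<in> cv R (below u)" "(u, t) \<in> conv (AC F)"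
  shows "(t, s) \<in> head_conv R"
  using assms below_conv[OF assms(3)] unfolding head_conv_def by (auto intro: conv_within_trans)

lemma join_mod_bounded:
  assumes "R \<subseteq> gt"
  shows "join_mod R (AC F) \<subseteq> bounded_conv R"
proof -
  have "(s, t) \<in> cv R W"
    if "(s, a) \<in> (rstep R)\<^sup>*" "(a, b) \<in> conv (AC F)" "(t, b) \<in> (rstep R)\<^sup>*"
      and W: "down_closed W" "s \<in> W" "t \<in> W" for s t a b W
  proof -
    have 1: "a \<in> W \<and> (s, a) \<in> cv R W" using cv_rsteps[OF that(1) assms W(1,2)] .
    moreover have "(a, b) \<in> cv R W" using cv_conv[OF that(2)] W 1 by blast
    moreover have "(b, t) \<in> cv R W" using cv_rsteps[OF that(3) assms W(1,3)] by (blast intro: cv_sym)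
    ultimately show ?thesis by (blast intro: conv_within_trans)
  qed
  then show ?thesis unfolding join_mod_def bounded_conv_def
    by (auto simp: rtrancl_converse)
qed

text \<open>If \<open>t\<close> made no step in the join, it would be AC-equivalent to the meeting
  point \<open>b\<close>, which lies strictly below \<open>t\<close>. The first step of
  \<open>t\<close> is the required head.\<close>

lemma join_mod_head:
  assumes "R \<subseteq> gt" "(t, s) \<in> join_mod R (AC F)" "(t, s) \<in> gt"
  shows "(t, s) \<in> head_conv R"
proof -
  from assms(2) obtain a b where *: "(t, a) \<in> (rstep R)\<^sup>*" "(a, b) \<in> conv (AC F)"
    "(s, b) \<in> (rstep R)\<^sup>*" by (auto simp: join_mod_def rtrancl_converse)
  have "b \<in> below t" using cv_rsteps[OF *(3) assms(1) down_closed_below, of t] assms(3) by blast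
  then have "t \<noteq> a" using *(2) gt_not_conv by blast
  then obtain u where u: "(t, u) \<in> rstep R" "(u, a) \<in> (rstep R)\<^sup>*"
    using *(1) by (metis converse_rtranclE)
  have "u \<in> below t" using u(1) rstep_gt[OF assms(1)] by blast
  moreover have "(u, s) \<in> bounded_conv R"
    using join_mod_bounded[OF assms(1)] u(2) *(2,3) unfolding join_mod_def
    by (auto simp: rtrancl_converse)
  ultimately have "(u, s) \<in> cv R (below t)"
    using assms(3) down_closed_below unfolding bounded_conv_def by blast
  then show ?thesis using u(1) by (auto simp: head_conv_def)
qed

end

section \<open>Fair runs are Church-Rosser modulo AC\<close>

lemma variant_stable:
  assumes "variant (l1, r1) (l2, r2)" "stable r" "(l2, r2) \<in> r"
  shows "(l1, r1) \<in> r"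
  using assms by (auto simp: variant_def intro: stable_subst)

text \<open>Fairness with the history of the run eliminated: only the final system is left. Covering
  rule steps may go either way, hence the converse of \<open>head_conv\<close>.\<close>

locale fair_trs = ac_reduction_order F gt
  for F :: "'f set" and gt :: "('f, 'v) term rel" +
  fixes R :: "('f, 'v) trs"
  assumes R_gt: "R \<subseteq> gt" and left_lin: "left_linear R"
    and peaks: "PCP R \<subseteq> bounded_conv R"
    and cliffs: "PCPpm R (pm (AC F)) \<subseteq> join_mod R (AC F) \<union> head_conv R \<union> (head_conv R)\<inverse>"
begin

lemma lhs_linear: "(l, r) \<in> R \<Longrightarrow> linear_term l"
  using left_lin by (auto simp: left_linear_def)

lemma in_below: "(u, s) \<in> rstep R \<Longrightarrow> s \<in> below u"
  using rstep_gt[OF R_gt] by blast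

text \<open>A head step from \<open>s\<close> to \<open>t\<close> would make \<open>s\<close> the
  larger term, against \<open>(t, s) \<in> gt\<close>, so the order selects the direction; the
  joinable case is \<open>join_mod_head\<close>.\<close>

lemma cliff_instance:
  assumes "(a, b) \<in> PCPpm R (pm (AC F))"
    and "(t, s) = (subst \<delta> a, subst \<delta> b) \<or> (s, t) = (subst \<delta> a, subst \<delta> b)"
    and "(t, s) \<in> gt"
  shows "(t, s) \<in> head_conv R"
proof -
  let ?J = "join_mod R (AC F) \<union> head_conv R \<union> (head_conv R)\<inverse>"
  have "stable ?J"
    by (intro stable_Un stable_converse stable_join_mod stable_head_conv)
  from stable_subst[OF this subsetD[OF cliffs assms(1)]]
  have "(subst \<delta> a, subst \<delta> b) \<in> ?J" .
  then have "(t, s) \<in> ?J" using assms(2) by (auto intro: join_mod_sym)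
  moreover have "(s, t) \<notin> head_conv R"
    using head_conv_gt[OF R_gt] assms(3) gt_trans gt_irrefl by blast
  ultimately show ?thesis using join_mod_head[OF R_gt _ assms(3)] by blast
qed

lemma root_peak:
  assumes step: "(subst \<sigma> l, s) \<in> rstep_at R q" and lr: "(l, r) \<in> R"
    and inner: "innermost_at R (subst \<sigma> l) q"
  shows "(s, subst \<sigma> r) \<in> bounded_conv R"
proof (cases "q \<in> fun_poss l")
  case False
  have "q \<in> poss (subst \<sigma> l)" using step by (auto simp: rstep_at_def)
  from variable_overlap[OF step lhs_linear[OF lr] this False] obtain \<tau> x where
    \<tau>: "s = subst \<tau> l" "(\<sigma> x, \<tau> x) \<in> rstep R" "\<And>y. y \<noteq> x \<Longrightarrow> \<tau> y = \<sigma> y" by metis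
  have "(\<sigma> y, \<tau> y) \<in> (rstep R)\<^sup>*" for y using \<tau>(2,3) by (cases "y = x") auto
  then have "(subst \<sigma> r, subst \<tau> r) \<in> (rstep R)\<^sup>*" by (rule rtrancl_subst[OF stable_rstep])
  moreover have "(s, subst \<tau> r) \<in> (rstep R)\<^sup>*"
    using stable_subst[OF stable_rstep rstep_rule[OF lr]] \<tau>(1) by blast
  ultimately have "(s, subst \<sigma> r) \<in> join_mod R (AC F)"
    unfolding join_mod_def by (meson conv_refl relcomp.relcompI rtrancl_converseI)
  then show ?thesis using join_mod_bounded[OF R_gt] by blast
next
  case True
  then have q: "q \<in> poss l" by (auto simp: fun_poss_def)
  from step obtain l' r' \<rho> where *: "(l', r') \<in> R" "subst \<sigma> (subt_at l q) = subst \<rho> l'"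
    "s = replace_at (subst \<sigma> l) q (subst \<rho> r')" using q by (auto simp: rstep_at_def)
  have inner': "\<forall>q \<in> poss (subst \<rho> l'). q \<noteq> [] \<longrightarrow> NF R (subt_at (subst \<rho> l') q)"
    using inner q *(2) by (simp add: innermost_at_def)
  from infinite_vars *(1) lr lhs_linear[OF *(1)] lhs_linear[OF lr] True *(2)[symmetric] inner'
  show ?thesis
  proof (cases rule: critical_overlap)
    case (pcp a b \<delta>)
    then have "(a, b) \<in> bounded_conv R" using peaks unfolding PCP_def by blast
    then show ?thesis using pcp *(3) stable_subst[OF stable_bounded_conv] by metis
  next
    \<comment> \<open>Both steps use the same rule up to renaming at the same position; since
      right-hand sides have no extra variables, the results coincide.\<close>
    case variant
    then obtain \<pi> where \<pi>: "l' = subst (Var \<circ> \<pi>) l" "r' = subst (Var \<circ> \<pi>) r"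
      by (auto simp: variant_def)
    have "subst \<sigma> l = subst (subst_comp (Var \<circ> \<pi>) \<rho>) l"
      using *(2) \<pi>(1) variant(1) by (simp add: subst_subst)
    then have "subst \<sigma> r = subst (subst_comp (Var \<circ> \<pi>) \<rho>) r"
      using gt_vars[of l r] lr R_gt unfolding subst_cong_iff by blast
    then have "s = subst \<sigma> r" using *(3) \<pi>(2) variant(1) by (simp add: subst_subst)
    then show ?thesis unfolding bounded_conv_def by simp
  qed
qed

lemma root_cliff_inner_rule:
  assumes step: "(subst \<sigma> l, s) \<in> rstep_at R q" and lr: "(l, r) \<in> pm (AC F)"
    and inner: "innermost_at R (subst \<sigma> l) q"
  shows "(subst \<sigma> r, s) \<in> head_conv R"
proof (cases "q \<in> fun_poss l")
  case False
  have "q \<in> poss (subst \<sigma> l)" using step by (auto simp: rstep_at_def)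
  from variable_overlap[OF step pm_AC_linear(1)[OF lr] this False] obtain \<tau> x where
    \<tau>: "s = subst \<tau> l" "x \<in> set (vars_list l)" "(\<sigma> x, \<tau> x) \<in> rstep R" "\<And>y. y \<noteq> x \<Longrightarrow> \<tau> y = \<sigma> y"
    by metis
  have step': "(subst \<sigma> r, subst \<tau> r) \<in> rstep R"
    using \<tau>(2) pm_AC_linear(3)[OF lr]
    by (intro linear_subst_rstep[where x = x and \<sigma> = \<sigma> and \<tau> = \<tau>] pm_AC_linear(2)[OF lr] \<tau>(3,4)) auto
  have "(subst \<tau> r, s) \<in> conv (AC F)"
    using stable_subst[OF stable_conv pm_conv[OF lr]] \<tau>(1) conv_sym by blast
  then have "(subst \<tau> r, s) \<in> cv R (below (subst \<sigma> r))"
    using cv_conv[OF _ down_closed_below] in_below[OF step'] by blast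
  then show ?thesis using step' by (auto simp: head_conv_def)
next
  case True
  then have q: "q \<in> poss l" by (auto simp: fun_poss_def)
  from step obtain l' r' \<rho> where *: "(l', r') \<in> R" "subst \<sigma> (subt_at l q) = subst \<rho> l'"
    "s = replace_at (subst \<sigma> l) q (subst \<rho> r')" using q by (auto simp: rstep_at_def)
  have inner': "\<forall>q \<in> poss (subst \<rho> l'). q \<noteq> [] \<longrightarrow> NF R (subt_at (subst \<rho> l') q)"
    using inner q *(2) by (simp add: innermost_at_def)
  from infinite_vars *(1) lr lhs_linear[OF *(1)] pm_AC_linear(1)[OF lr] True *(2)[symmetric] inner'
  show ?thesis
  proof (cases rule: critical_overlap)
    case (pcp a b \<delta>)
    have "(subst \<sigma> l, s) \<in> gt" using in_below[OF rstep_at_rstep[OF step]] by blast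
    moreover have "(subst \<sigma> r, subst \<sigma> l) \<in> conv (AC F)"
      using stable_subst[OF stable_conv pm_conv[OF lr]] conv_sym by blast
    ultimately have "(subst \<sigma> r, s) \<in> gt" using conv_gt by blast
    then show ?thesis using pcp *(3) unfolding PCPpm_def
      by (intro cliff_instance[where a = a and b = b and \<delta> = \<delta>]) (auto simp: PCPpm_def)
  next
    \<comment> \<open>No rule is a variant of an AC equation: rules decrease, whereas a term is
      never above an AC-equivalent one.\<close>
    case variant
    then have "(l', r') \<in> conv (AC F)" using variant_stable[OF _ stable_conv pm_conv[OF lr]] by blast
    then show ?thesis using gt_not_conv *(1) R_gt by blast
  qed
qed

text \<open>An AC step inside the substitution leaves the redex of a left-linear rule intact, so the
  same rule still applies to \<open>t\<close> at the root, with a result AC-equivalent to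
  \<open>subst \<sigma> r\<close>. In a critical overlap the inner step is the AC step, yet
  \<open>inner\<close> speaks of redexes of \<open>R\<close>, in accordance with primality.\<close>

lemma root_cliff_inner_equation:
  assumes step: "(subst \<sigma> l, t) \<in> rstep_at (pm (AC F)) q" and lr: "(l, r) \<in> R"
    and inner: "innermost_at R (subst \<sigma> l) q"
  shows "(t, subst \<sigma> r) \<in> head_conv R"
proof (cases "q \<in> fun_poss l")
  case False
  have "q \<in> poss (subst \<sigma> l)" using step by (auto simp: rstep_at_def)
  from variable_overlap[OF step lhs_linear[OF lr] this False] obtain \<tau> x where
    \<tau>: "t = subst \<tau> l" "(\<sigma> x, \<tau> x) \<in> sstep (AC F)" "\<And>y. y \<noteq> x \<Longrightarrow> \<tau> y = \<sigma> y"
    unfolding sstep_eq_rstep_pm by metis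
  have "(\<sigma> y, \<tau> y) \<in> (sstep (AC F))\<^sup>*" for y using \<tau>(2,3) by (cases "y = x") auto
  then have "(subst \<sigma> r, subst \<tau> r) \<in> conv (AC F)"
    unfolding conv_def by (rule rtrancl_subst[OF stable_sstep])
  then have c: "(subst \<tau> r, subst \<sigma> r) \<in> conv (AC F)" by (rule conv_sym)
  have step': "(t, subst \<tau> r) \<in> rstep R"
    using stable_subst[OF stable_rstep rstep_rule[OF lr]] \<tau>(1) by blast
  have "(subst \<tau> r, subst \<sigma> r) \<in> cv R (below t)"
    using cv_conv[OF c down_closed_below] in_below[OF step'] by blast
  then show ?thesis using step' by (auto simp: head_conv_def)
next
  case True
  then have q: "q \<in> poss l" by (auto simp: fun_poss_def)
  from step obtain l' r' \<rho> where *: "(l', r') \<in> pm (AC F)" "subst \<sigma> (subt_at l q) = subst \<rho> l'"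
    "t = replace_at (subst \<sigma> l) q (subst \<rho> r')" using q by (auto simp: rstep_at_def)
  have inner': "\<forall>q \<in> poss (subst \<rho> l'). q \<noteq> [] \<longrightarrow> NF R (subt_at (subst \<rho> l') q)"
    using inner q *(2) by (simp add: innermost_at_def)
  from infinite_vars *(1) lr pm_AC_linear(1)[OF *(1)] lhs_linear[OF lr] True *(2)[symmetric] inner'
  show ?thesis
  proof (cases rule: critical_overlap)
    case (pcp a b \<delta>)
    have "(t, subst \<sigma> l) \<in> conv (AC F)"
      using rstep_at_rstep[OF step] conv_sym unfolding conv_def sstep_eq_rstep_pm by blast
    moreover have "(subst \<sigma> l, subst \<sigma> r) \<in> gt"
      using stable_subst[OF gt_stable] lr R_gt by blast
    ultimately have "(t, subst \<sigma> r) \<in> gt" using conv_gt by blast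
    then show ?thesis using pcp *(3)
      by (intro cliff_instance[where a = a and b = b and \<delta> = \<delta>]) (auto simp: PCPpm_def)
  next
    case variant
    then have "(l', r') \<in> gt" using variant_stable[OF _ gt_stable] lr R_gt by blast
    then show ?thesis using gt_not_conv pm_conv[OF *(1)] by blast
  qed
qed

lemma nested_innermost_peak:
  assumes "(u, s) \<in> rstep_at R (p @ q)" "(u, t) \<in> rstep_at R p" "innermost_at R u (p @ q)"
  shows "(s, t) \<in> cv R (below u)"
proof -
  from assms(1) obtain s' where s': "p \<in> poss u" "(subt_at u p, s') \<in> rstep_at R q"
    "s = replace_at u p s'" by (rule rstep_at_append)
  from assms(2) obtain l r \<sigma> where lr: "(l, r) \<in> R" "subt_at u p = subst \<sigma> l"
    "t = replace_at u p (subst \<sigma> r)" by (auto simp: rstep_at_def)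
  have "(s', subst \<sigma> r) \<in> bounded_conv R"
    using root_peak[of \<sigma> l s' q r] s' lr assms(3) by (simp add: innermost_at_append)
  then have "(s, t) \<in> bounded_conv R"
    using stable_ctxt[OF stable_bounded_conv] s'(1,3) lr(3) by blast
  then show ?thesis using in_below[OF rstep_at_rstep[OF assms(1)]]
    in_below[OF rstep_at_rstep[OF assms(2)]] down_closed_below unfolding bounded_conv_def by blast
qed

lemma nested_innermost_cliff_inner_rule:
  assumes "(u, s) \<in> rstep_at R (p @ q)" "(u, t) \<in> rstep_at (pm (AC F)) p" "innermost_at R u (p @ q)"
  shows "(t, s) \<in> head_conv R"
proof -
  from assms(1) obtain s' where s': "p \<in> poss u" "(subt_at u p, s') \<in> rstep_at R q"
    "s = replace_at u p s'" by (rule rstep_at_append)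
  from assms(2) obtain l r \<sigma> where lr: "(l, r) \<in> pm (AC F)" "subt_at u p = subst \<sigma> l"
    "t = replace_at u p (subst \<sigma> r)" by (auto simp: rstep_at_def)
  have "(subst \<sigma> r, s') \<in> head_conv R"
    using root_cliff_inner_rule[of \<sigma> l s' q r] s' lr assms(3) by (simp add: innermost_at_append)
  then show ?thesis using stable_ctxt[OF stable_head_conv] s'(1,3) lr(3) by blast
qed

lemma nested_innermost_cliff_inner_equation:
  assumes "(u, t) \<in> rstep_at (pm (AC F)) (p @ q)" "(u, s) \<in> rstep_at R p" "innermost_at R u (p @ q)"
  shows "(t, s) \<in> head_conv R"
proof -
  from assms(1) obtain t' where t': "p \<in> poss u" "(subt_at u p, t') \<in> rstep_at (pm (AC F)) q"
    "t = replace_at u p t'" by (rule rstep_at_append)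
  from assms(2) obtain l r \<sigma> where lr: "(l, r) \<in> R" "subt_at u p = subst \<sigma> l"
    "s = replace_at u p (subst \<sigma> r)" by (auto simp: rstep_at_def)
  have "(t', subst \<sigma> r) \<in> head_conv R"
    using root_cliff_inner_equation[of \<sigma> l t' q r] t' lr assms(3) by (simp add: innermost_at_append)
  then show ?thesis using stable_ctxt[OF stable_head_conv] t'(1,3) lr(3) by blast
qed

text \<open>A redex contracted by a non-prime overlap has an innermost redex strictly below it;
  contracting the latter splits the peak into two innermost ones.\<close>

lemma nested_peak:
  assumes "(u, s) \<in> rstep_at R (p @ q)" "(u, t) \<in> rstep_at R p"
  shows "(s, t) \<in> cv R (below u)"
proof (cases "innermost_at R u (p @ q)")
  case True
  then show ?thesis using nested_innermost_peak assms by blast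
next
  case False
  have "p @ q \<in> poss u" using assms(1) by (auto simp: rstep_at_def)
  from innermost_below[OF this False] obtain q' w where
    w: "(u, w) \<in> rstep_at R ((p @ q) @ q')" "innermost_at R u ((p @ q) @ q')" by blast
  have "(w, s) \<in> cv R (below u)" using nested_innermost_peak[OF w(1) assms(1) w(2)] .
  moreover have "(w, t) \<in> cv R (below u)"
    using nested_innermost_peak[of u w p "q @ q'" t] w assms(2) by simp
  ultimately show ?thesis by (blast intro: cv_sym conv_within_trans)
qed

lemma local_peak:
  assumes "(u, s) \<in> rstep R" "(u, t) \<in> rstep R"
  shows "(s, t) \<in> cv R (below u)"
proof -
  obtain p q where p: "(u, s) \<in> rstep_at R p" and q: "(u, t) \<in> rstep_at R q"
    using assms rstep_rstep_at by metis
  consider (a) r where "q = p @ r" | (b) r where "p = q @ r"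
    | (c) "\<not> (\<exists>r. q = p @ r)" "\<not> (\<exists>r. p = q @ r)" by blast
  then show ?thesis
  proof cases
    case a
    then show ?thesis using nested_peak[of u t p r s] p q by (blast intro: cv_sym)
  next
    case b
    then show ?thesis using nested_peak[of u s q r t] p q by blast
  next
    case c
    from parallel_rsteps_commute[OF p q c] obtain v where v: "(s, v) \<in> rstep R" "(t, v) \<in> rstep R" .
    have "(s, v) \<in> cv R (below u)" "(t, v) \<in> cv R (below u)"
      using cv_rsteps[OF r_into_rtrancl R_gt down_closed_below] v in_below assms by blast+
    then show ?thesis by (blast intro: cv_sym conv_within_trans)
  qed
qed

text \<open>If the inner of two nested steps is not innermost, there is an innermost
  \<open>R\<close>-redex strictly below it, even when that inner step is the AC step. Its
  contraction to \<open>w\<close> has the AC step above it, which gives a cliff already dealt with,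
  and \<open>local_peak\<close> leads from \<open>w\<close> back to \<open>s\<close>.\<close>

lemma local_cliff:
  assumes "(u, s) \<in> rstep R" "(u, t) \<in> sstep (AC F)"
  shows "(t, s) \<in> head_conv R"
proof -
  have ut: "(u, t) \<in> conv (AC F)" using assms(2) by (auto simp: conv_def)
  have nested: "(t, s) \<in> head_conv R"
    if "(u, w) \<in> rstep_at R (q @ q')" "innermost_at R u (q @ q')" "(u, t) \<in> rstep_at (pm (AC F)) q"
    for w q q'
    using nested_innermost_cliff_inner_rule[OF that(1,3,2)]
      local_peak[OF rstep_at_rstep[OF that(1)] assms(1)] ut by (rule head_conv_trans)
  obtain p q where p: "(u, s) \<in> rstep_at R p" and q: "(u, t) \<in> rstep_at (pm (AC F)) q"
    using assms unfolding sstep_eq_rstep_pm using rstep_rstep_at by metis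
  consider (a) r where "q = p @ r" | (b) r where "p = q @ r"
    | (c) "\<not> (\<exists>r. q = p @ r)" "\<not> (\<exists>r. p = q @ r)" by blast
  then show ?thesis
  proof cases
    case a
    show ?thesis
    proof (cases "innermost_at R u q")
      case True
      then show ?thesis using nested_innermost_cliff_inner_equation a p q by blast
    next
      case False
      have "q \<in> poss u" using q by (auto simp: rstep_at_def)
      from innermost_below[OF this False] show ?thesis using nested[OF _ _ q] by metis
    qed
  next
    case b
    show ?thesis
    proof (cases "innermost_at R u p")
      case True
      then show ?thesis using nested_innermost_cliff_inner_rule b p q by blast
    next
      case False
      have "p \<in> poss u" using p by (auto simp: rstep_at_def)
      from innermost_below[OF this False] show ?thesis
        using nested[OF _ _ q] b append_assoc by metis
    qed
  next
    case c
    from parallel_rsteps_commute[OF p q c] obtain v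
      where v: "(s, v) \<in> rstep (pm (AC F))" "(t, v) \<in> rstep R" .
    have "(v, s) \<in> conv (AC F)"
      using v(1) conv_sym unfolding conv_def sstep_eq_rstep_pm by blast
    then have "(v, s) \<in> cv R (below t)" using cv_conv[OF _ down_closed_below] in_below[OF v(2)] by blast
    then show ?thesis using v(2) by (auto simp: head_conv_def)
  qed
qed

theorem church_rosser: "conv (R \<union> AC F) \<subseteq> join_mod R (AC F)"
proof -
  have eq: "sstep (R \<union> AC F) = rstep R \<union> (rstep R)\<inverse> \<union> sstep (AC F)"
    by (simp add: sstep_Un) (simp add: sstep_def)
  have "(rstep R \<union> (rstep R)\<inverse> \<union> sstep (AC F))\<^sup>* \<subseteq>
    (rstep R)\<^sup>* O (sstep (AC F))\<^sup>* O ((rstep R)\<inverse>)\<^sup>*"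
  proof (rule church_rosser_modulo[OF gt_wf rstep_gt[OF R_gt]])
    show "sym (sstep (AC F))" by (auto simp: sym_def intro: sstep_sym)
    show "(sstep (AC F))\<^sup>* O gt O (sstep (AC F))\<^sup>* \<subseteq> gt" using gt_compat unfolding conv_def .
    show "(s, t) \<in> conv_within (rstep R \<union> (rstep R)\<inverse> \<union> sstep (AC F)) (below u)"
      if "(u, s) \<in> rstep R" "(u, t) \<in> rstep R" for u s t
      using local_peak[OF that] unfolding eq .
    show "\<exists>t'. (t, t') \<in> rstep R \<and>
        (t', s) \<in> conv_within (rstep R \<union> (rstep R)\<inverse> \<union> sstep (AC F)) (below u)"
      if "(u, s) \<in> rstep R" "(u, t) \<in> sstep (AC F)" for u s t
    proof -
      have "(u, t) \<in> conv (AC F)" using that(2) by (auto simp: conv_def)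
      then show ?thesis using local_cliff[OF that] below_conv[of u t]
        unfolding head_conv_def eq by auto
    qed
  qed
  then show ?thesis unfolding join_mod_def conv_def eq .
qed

end

section \<open>Invariants of the given run\<close>

context ac_reduction_order
begin

lemma IA_step_gt:
  assumes "IA_step (AC F) gt (E, R) (E', R')" "R \<subseteq> gt"
  shows "R' \<subseteq> gt"
  using assms(1)
proof cases
  case (deduce_cliff s t)
  then obtain u where "(u, s) \<in> rstep R" "(u, t) \<in> sstep (AC F)" by blast
  then have "(u, s) \<in> gt" "(u, t) \<in> conv (AC F)" using rstep_gt[OF assms(2)] by (auto simp: conv_def)
  then have "(t, s) \<in> gt" by (blast intro: conv_gt conv_sym)
  then show ?thesis using deduce_cliff assms(2) by blast
next
  case (compose s t u)
  then have "(t, u) \<in> gt" using relmod_gt[of "R - {(s, t)}"] assms(2) by blast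
  then show ?thesis using compose assms(2) gt_trans by blast
qed (use assms(2) in auto)

text \<open>A removed item is rebuilt from what replaced it: a collapsed rule from the reduction of
  its left-hand side and the new equation, a composed one from the new rule and the way back from
  \<open>u\<close> to \<open>t\<close>. Collapse by plain steps is essential: a step modulo AC might
  begin with an AC conversion, and no head step out of \<open>s\<close> would be guaranteed.\<close>

lemma IA_step_bounded:
  assumes "IA_step (AC F) gt (E, R) (E', R')" "R \<subseteq> gt" "S \<subseteq> gt"
    and E': "E' \<subseteq> bounded_conv S" and R': "R' \<subseteq> head_conv S"
  shows "E \<subseteq> bounded_conv S \<and> R \<subseteq> head_conv S"
  using assms(1)
proof cases
  case (orient e s t)
  then have "(s, t) \<in> bounded_conv S" using R' head_conv_bounded[OF assms(3)] by blast
  then have "e \<in> bounded_conv S" using orient bounded_conv_sym by blast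
  then show ?thesis using orient E' R' by blast
next
  case (delete s t)
  have "(s, t) \<in> bounded_conv S"
    using cv_conv[OF delete(4)] unfolding bounded_conv_def by blast
  then show ?thesis using delete E' R' by blast
next
  case (simplify e s t u)
  have "(s, t) \<in> bounded_conv S" unfolding bounded_conv_def
  proof clarify
    fix W assume W: "down_closed W" "s \<in> W" "t \<in> W"
    have "u \<in> W \<and> (s, u) \<in> cv S W"
      using head_conv_relmod[OF _ _ assms(3) W(1,2)] simplify R' by blast
    moreover then have "(u, t) \<in> cv S W" using simplify E' W unfolding bounded_conv_def by blast
    ultimately show "(s, t) \<in> cv S W" by (blast intro: conv_within_trans)
  qed
  then have "e \<in> bounded_conv S" using simplify bounded_conv_sym by blast
  then show ?thesis using simplify E' R' by blast
next
  case (collapse s t u)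
  have "rstep (R - {(s, t)}) \<subseteq> head_conv S"
    using collapse R' by (intro rstep_least[OF stable_head_conv]) blast
  then obtain v where v: "(s, v) \<in> rstep S" "(v, u) \<in> cv S (below s)"
    using collapse(4) by (auto simp: head_conv_def)
  have "(s, u) \<in> gt" using v rstep_gt[OF assms(3)] conv_within_closed[OF v(2)] by blast
  moreover have "(s, t) \<in> gt" using collapse assms(2) by blast
  ultimately have "(u, t) \<in> cv S (below s)"
    using collapse E' down_closed_below unfolding bounded_conv_def by blast
  then have "(s, t) \<in> head_conv S" using v by (auto simp: head_conv_def intro: conv_within_trans)
  then show ?thesis using collapse E' R' by blast
next
  case (compose s t u)
  have "(s, u) \<in> head_conv S" using compose R' by blast
  then obtain v where v: "(s, v) \<in> rstep S" "(v, u) \<in> cv S (below s)"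
    by (auto simp: head_conv_def)
  have "t \<in> below s" using compose assms(2) by blast
  then have "(t, u) \<in> cv S (below s)"
    using head_conv_relmod[OF compose(4) _ assms(3) down_closed_below] compose R' by blast
  then have "(s, t) \<in> head_conv S"
    using v by (auto simp: head_conv_def intro: conv_within_trans cv_sym)
  then show ?thesis using compose E' R' by blast
qed (use E' R' in auto)

lemma fair_run_church_rosser:
  assumes run: "run (IA_step (AC F) gt) E S n" and Sn: "S n = ({}, R)"
    and fair: "fair_run (AC F) S n"
  shows "conv (R \<union> AC F) \<subseteq> join_mod R (AC F)" "E \<subseteq> conv (R \<union> AC F)"
proof -
  have IA: "IA_step (AC F) gt (fst (S i), snd (S i)) (fst (S (Suc i)), snd (S (Suc i)))"
    if "i < n" for i using run that by (simp add: run_def)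
  have gt: "i \<le> n \<Longrightarrow> snd (S i) \<subseteq> gt" for i
  proof (induction i)
    case 0
    then show ?case using run by (simp add: run_def)
  next
    case (Suc i)
    then show ?case using IA_step_gt[OF IA] by simp
  qed
  then have R_gt: "R \<subseteq> gt" using Sn by fastforce
  have bounded: "fst (S i) \<subseteq> bounded_conv R \<and> snd (S i) \<subseteq> head_conv R" if "i \<le> n" for i
    using that
  proof (induction rule: inc_induct)
    \<comment> \<open>At the end no equation is left, and a rule of \<open>R\<close> is its own head
      step followed by the empty conversion.\<close>
    case base
    show ?case using Sn by (auto simp: head_conv_def intro: rstep_rule)
  next
    case (step i)
    then show ?case using IA_step_bounded[OF IA gt R_gt] by simp
  qed
  have peaks: "sstep (fst (S i) \<union> snd (S i)) \<subseteq> bounded_conv R" if "i \<le> n" for i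
  proof -
    have "rstep (fst (S i) \<union> snd (S i)) \<subseteq> bounded_conv R"
      using bounded[OF that] head_conv_bounded[OF R_gt]
      by (intro rstep_least[OF stable_bounded_conv]) blast
    then show ?thesis by (auto simp: sstep_def intro: bounded_conv_sym)
  qed
  have cliffs: "sstep (snd (S i)) \<subseteq> head_conv R \<union> (head_conv R)\<inverse>" if "i \<le> n" for i
  proof -
    have "rstep (snd (S i)) \<subseteq> head_conv R"
      using bounded[OF that] by (intro rstep_least[OF stable_head_conv]) blast
    then show ?thesis by (auto simp: sstep_def)
  qed
  interpret fair_trs F gt R
  proof
    show "R \<subseteq> gt" by (rule R_gt)
    show "left_linear R" using fair Sn by (simp add: fair_run_def)
    have "PCP R \<subseteq> join_mod R (AC F) \<union> (\<Union>i \<le> n. sstep (fst (S i) \<union> snd (S i)))"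
      using fair Sn by (simp add: fair_run_def)
    then show "PCP R \<subseteq> bounded_conv R" using peaks join_mod_bounded[OF R_gt] by blast
    have "PCPpm R (pm (AC F)) \<subseteq> join_mod R (AC F) \<union> (\<Union>i \<le> n. sstep (snd (S i)))"
      using fair Sn by (simp add: fair_run_def)
    then show "PCPpm R (pm (AC F)) \<subseteq> join_mod R (AC F) \<union> head_conv R \<union> (head_conv R)\<inverse>"
      using cliffs by blast
  qed
  show "conv (R \<union> AC F) \<subseteq> join_mod R (AC F)" by (rule church_rosser)
  \<comment> \<open>With all terms as the bound, a bounded conversion is an ordinary one.\<close>
  have "down_closed UNIV" by (simp add: down_closed_def)
  moreover have "E \<subseteq> bounded_conv R" using bounded[of 0] run by (simp add: run_def)
  moreover have "cv R UNIV \<subseteq> conv (R \<union> AC F)"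
    unfolding conv_within_def conv_def by (rule rtrancl_mono) auto
  ultimately show "E \<subseteq> conv (R \<union> AC F)" unfolding bounded_conv_def by blast
qed

end

section \<open>Simulation by AC completion\<close>

lemma rtrancl_path:
  assumes "(x, y) \<in> r\<^sup>*"
  obtains k f where "f 0 = x" "f k = y" "\<forall>i < k. (f i, f (Suc i)) \<in> r"
  using rtrancl_imp_relpow[OF assms] by (auto simp: relpow_fun_conv)

context ac_reduction_order
begin

abbreviation rew :: "('f, 'v) trs \<Rightarrow> ('f, 'v) term rel" where
  "rew R \<equiv> relmod R (AC F)"

text \<open>Equal to the transitive closure of \<open>rew R\<close> except that a single step must end exactly, not only
  modulo AC, in the contractum; this is what Deduce produces.\<close>

definition reducts :: "('f, 'v) trs \<Rightarrow> ('f, 'v) term rel" where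
  "reducts R = conv (AC F) O rstep R O (rew R)\<^sup>*"

text \<open>Up to swapping sides, these are the equations that Deduce followed by Simplify can
  produce from \<open>R\<close> alone.\<close>

definition siblings :: "('f, 'v) trs \<Rightarrow> ('f, 'v) trs" where
  "siblings R = (reducts R)\<inverse> O reducts R"

text \<open>Simplify puts the rewritten side first, whichever it was, so the sides of an equation
  may change places along a path.\<close>

definition simp_eq :: "('f, 'v) trs \<Rightarrow> ('f, 'v) rule rel" where
  "simp_eq R = {(e, (u, t)) | e s t u. (e = (s, t) \<or> e = (t, s)) \<and> (s, u) \<in> rew R}"

lemma stable_reducts: "stable (reducts R)"
  unfolding reducts_def by (intro stable_relcomp stable_conv stable_rstep stable_rtrancl stable_relmod)

lemma rstep_reducts: "(s, t) \<in> rstep R \<Longrightarrow> (s, t) \<in> reducts R"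
  unfolding reducts_def by (meson conv_refl relcomp.relcompI rtrancl.rtrancl_refl)

lemma conv_reducts: "(s, t) \<in> conv (AC F) \<Longrightarrow> (t, u) \<in> reducts R \<Longrightarrow> (s, u) \<in> reducts R"
  unfolding reducts_def by (blast intro: conv_trans)

lemma reducts_rew: "(s, t) \<in> reducts R \<Longrightarrow> (t, u) \<in> (rew R)\<^sup>* \<Longrightarrow> (s, u) \<in> reducts R"
  unfolding reducts_def by (blast intro: rtrancl_trans)

lemma reducts_mono: "R \<subseteq> R' \<Longrightarrow> reducts R \<subseteq> reducts R'"
  unfolding reducts_def by (intro relcomp_mono rstep_mono rtrancl_mono relmod_mono order_refl)

lemma siblings_mono: "R \<subseteq> R' \<Longrightarrow> siblings R \<subseteq> siblings R'"
  unfolding siblings_def using reducts_mono[of R R'] by blast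

lemma simp_eq_mono: "R \<subseteq> R' \<Longrightarrow> simp_eq R \<subseteq> simp_eq R'"
  unfolding simp_eq_def using relmod_mono[of R R' "AC F"] by blast

lemma reducts_trancl: "(s, t) \<in> reducts R \<Longrightarrow> (s, t) \<in> (rew R)\<^sup>+"
proof -
  assume "(s, t) \<in> reducts R"
  then obtain a b where "(s, a) \<in> conv (AC F)" "(a, b) \<in> rstep R" "(b, t) \<in> (rew R)\<^sup>*"
    by (auto simp: reducts_def)
  then have "(s, b) \<in> rew R" "(b, t) \<in> (rew R)\<^sup>*" by (auto intro: relmodI)
  then show ?thesis by (rule rtrancl_into_trancl2)
qed

lemma relmod_reducts_trancl:
  assumes "R \<subseteq> reducts R'" "(s, t) \<in> rew R"
  shows "(s, t) \<in> (rew R')\<^sup>+"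
proof -
  from assms(2) obtain a b where *: "(s, a) \<in> conv (AC F)" "(a, b) \<in> rstep R" "(b, t) \<in> conv (AC F)"
    by (rule relmodE)
  have "(a, b) \<in> reducts R'" using *(2) rstep_least[OF stable_reducts assms(1)] by blast
  then have "(s, b) \<in> (rew R')\<^sup>+" using conv_reducts[OF *(1)] reducts_trancl by blast
  \<comment> \<open>The trailing AC conversion is absorbed by the last step, which exists because
    the sequence is nonempty.\<close>
  then obtain c where "(s, c) \<in> (rew R')\<^sup>*" "(c, b) \<in> rew R'" by (meson tranclD2)
  then show ?thesis using relmod_conv[OF _ *(3)] by (meson rtrancl_into_trancl1)
qed

lemma siblings_sym: "(s, t) \<in> siblings R \<Longrightarrow> (t, s) \<in> siblings R"
  unfolding siblings_def by blast

text \<open>Used contrapositively: the ancestor of an equation outside \<open>siblings R\<close> is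
  outside as well, so it survives any processing of siblings.\<close>

lemma siblings_simp: "(e, e') \<in> (simp_eq R)\<^sup>* \<Longrightarrow> e \<in> siblings R \<Longrightarrow> e' \<in> siblings R"
proof (induction rule: rtrancl_induct)
  case (step e e')
  then obtain s t u where *: "e = (s, t) \<or> e = (t, s)" "e' = (u, t)" "(s, u) \<in> rew R"
    by (auto simp: simp_eq_def)
  then have "(s, t) \<in> siblings R" using step siblings_sym by blast
  then have "(u, t) \<in> siblings R" unfolding siblings_def using reducts_rew *(3) by blast
  then show ?case using *(2) by simp
qed simp

lemma simp_eq_rtrancl: "(s, u) \<in> (rew R)\<^sup>* \<Longrightarrow> ((s, t), (u, t)) \<in> (simp_eq R)\<^sup>*"
proof (induction rule: rtrancl_induct)
  case (step v w)
  then have "((v, t), (w, t)) \<in> simp_eq R" by (auto simp: simp_eq_def)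
  then show ?case using step by (meson rtrancl_into_rtrancl)
qed simp

text \<open>The reduction has to be nonempty because only an actual rewrite can exchange the sides
  of \<open>(t, s)\<close>.\<close>

lemma simp_eq_trancl:
  assumes "(s, u) \<in> (rew R)\<^sup>+" "e = (s, t) \<or> e = (t, s)"
  shows "(e, (u, t)) \<in> (simp_eq R)\<^sup>*"
proof -
  from assms(1) obtain v where v: "(s, v) \<in> rew R" "(v, u) \<in> (rew R)\<^sup>*" by (meson tranclD)
  then have "(e, (v, t)) \<in> simp_eq R" using assms(2) by (auto simp: simp_eq_def)
  then show ?thesis using simp_eq_rtrancl[OF v(2)] by (meson converse_rtrancl_into_rtrancl)
qed

text \<open>Rewriting the second side after the first brings it to the front, so the resulting
  orientation depends on whether \<open>t\<close> moves at all.\<close>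

lemma simp_eq_both:
  assumes "(s, a) \<in> (rew R)\<^sup>*" "(t, b) \<in> (rew R)\<^sup>*"
  obtains x where "x = (a, b) \<or> x = (b, a)" "((s, t), x) \<in> (simp_eq R)\<^sup>*"
proof (cases "t = b")
  case True
  then show thesis using that[of "(a, b)"] simp_eq_rtrancl[OF assms(1)] by blast
next
  case False
  then have "(t, b) \<in> (rew R)\<^sup>+" using assms(2) by (simp add: rtrancl_eq_or_trancl)
  then have "((a, t), (b, a)) \<in> (simp_eq R)\<^sup>*" by (rule simp_eq_trancl) simp
  then show thesis using that[of "(b, a)"] simp_eq_rtrancl[OF assms(1)] by (meson rtrancl_trans)
qed

section \<open>AC completion along simplification paths, and the simulation relation\<close>

abbreviation KBs :: "('f, 'v) state \<Rightarrow> ('f, 'v) state \<Rightarrow> bool" where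
  "KBs \<equiv> (KBAC_step F gt)\<^sup>*\<^sup>*"

text \<open>An equation on the path that was already in \<open>E\<close> merges with the one under
  way and is consumed with it, so only members off the path are sure to remain. This lower bound
  serves the simulation, the upper bound the final clean-up.\<close>

lemma KB_simplify_path:
  assumes "f 0 \<in> E" "\<forall>i < k. (f i, f (Suc i)) \<in> simp_eq R"
  shows "\<exists>E'. KBs (E, R) (E', R) \<and> f k \<in> E' \<and> E' \<subseteq> E - {f 0} \<union> {f k} \<and> E - f ` {..k} \<subseteq> E'"
  using assms(2)
proof (induction k)
  case 0
  then show ?case using assms(1) by (intro exI[of _ E]) auto
next
  case (Suc k)
  then obtain E' where E': "KBs (E, R) (E', R)" "f k \<in> E'" "E' \<subseteq> E - {f 0} \<union> {f k}"
    "E - f ` {..k} \<subseteq> E'" by auto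
  from Suc.prems have "(f k, f (Suc k)) \<in> simp_eq R" by blast
  then obtain s t u where *: "f k = (s, t) \<or> f k = (t, s)" "f (Suc k) = (u, t)" "(s, u) \<in> rew R"
    by (auto simp: simp_eq_def)
  have "KBAC_step F gt (E', R) (E' - {f k} \<union> {f (Suc k)}, R)"
    unfolding *(2) using E'(2) *(1,3) by (rule KBAC_step.simplify)
  then have "KBs (E, R) (E' - {f k} \<union> {f (Suc k)}, R)" using E'(1) by simp
  moreover have "E - f ` {..Suc k} \<subseteq> E' - {f k} \<union> {f (Suc k)}"
    using E'(4) by (auto simp: atMost_Suc)
  moreover have "E' - {f k} \<union> {f (Suc k)} \<subseteq> E - {f 0} \<union> {f (Suc k)}" using E'(3) by blast
  ultimately show ?case by blast
qed

text \<open>Only the orientations of the run are imitated, and rules are never removed. Equations that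
  are siblings can be deduced again at any time. Every other equation is represented by an ancestor
  of its own, from which it is recovered by simplification only when it gets oriented; since states
  are sets, two equations sharing an ancestor could not both be recovered.\<close>

definition simulates :: "('f, 'v) state \<Rightarrow> ('f, 'v) state \<Rightarrow> bool" where
  "simulates = (\<lambda>(E', R') (E, R). R \<subseteq> reducts R' \<and>
    (\<exists>\<phi>. inj_on \<phi> (E - siblings R') \<and>
      (\<forall>e \<in> E - siblings R'. \<phi> e \<in> E' \<and> (\<phi> e, e) \<in> (simp_eq R')\<^sup>*)))"

lemma simulatesI:
  assumes "R \<subseteq> reducts R'" "inj_on \<phi> (E - siblings R')"
    "\<And>e. e \<in> E \<Longrightarrow> e \<notin> siblings R' \<Longrightarrow> \<phi> e \<in> E' \<and> (\<phi> e, e) \<in> (simp_eq R')\<^sup>*"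
  shows "simulates (E', R') (E, R)"
  using assms unfolding simulates_def by blast

lemma simulatesE:
  assumes "simulates (E', R') (E, R)"
  obtains \<phi> where "R \<subseteq> reducts R'" "inj_on \<phi> (E - siblings R')"
    "\<And>e. e \<in> E \<Longrightarrow> e \<notin> siblings R' \<Longrightarrow> \<phi> e \<in> E' \<and> (\<phi> e, e) \<in> (simp_eq R')\<^sup>*"
  using assms unfolding simulates_def by blast

lemma simulates_antimono:
  assumes "simulates (E', R') (E, R)" "R2 \<subseteq> reducts R'" "E2 \<subseteq> E \<union> siblings R'"
  shows "simulates (E', R') (E2, R2)"
proof -
  from assms(1) obtain \<phi> where "R \<subseteq> reducts R'" "inj_on \<phi> (E - siblings R')"
    "\<And>e. e \<in> E \<Longrightarrow> e \<notin> siblings R' \<Longrightarrow> \<phi> e \<in> E' \<and> (\<phi> e, e) \<in> (simp_eq R')\<^sup>*"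
    by (elim simulatesE that)
  then show ?thesis using assms(2,3)
    by (intro simulatesI[of _ _ \<phi>]) (blast intro: inj_on_subset)+
qed

text \<open>No inference is made: the ancestor of \<open>e\<close> is kept and its path extended by
  the rewrite. If \<open>(u, t)\<close> is a sibling or already present, \<open>e\<close> just
  disappears. Otherwise \<open>e\<close> is no sibling either, since siblings simplify to siblings,
  and so has an ancestor to hand over.\<close>

lemma simulates_simplify:
  assumes sim: "simulates (E', R') (E, R)" and e: "e \<in> E" "e = (s, t) \<or> e = (t, s)"
    and u: "(s, u) \<in> rew R"
  shows "simulates (E', R') (E - {e} \<union> {(u, t)}, R)"
proof -
  from sim obtain \<phi> where \<phi>: "R \<subseteq> reducts R'" "inj_on \<phi> (E - siblings R')"
    "\<And>e. e \<in> E \<Longrightarrow> e \<notin> siblings R' \<Longrightarrow> \<phi> e \<in> E' \<and> (\<phi> e, e) \<in> (simp_eq R')\<^sup>*"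
    by (elim simulatesE that)
  have path: "(e, (u, t)) \<in> (simp_eq R')\<^sup>*"
    using relmod_reducts_trancl[OF \<phi>(1) u] e(2) by (rule simp_eq_trancl)
  show ?thesis
  proof (cases "(u, t) \<in> siblings R' \<or> (u, t) \<in> E - {e}")
    case True
    then show ?thesis by (intro simulates_antimono[OF sim \<phi>(1)]) auto
  next
    case False
    then have es: "e \<notin> siblings R'" using siblings_simp[OF path] by blast
    have inj: "\<phi> x \<noteq> \<phi> e" if "x \<in> E - {e}" "x \<notin> siblings R'" for x
      using \<phi>(2) that e(1) es by (auto simp: inj_on_def)
    show ?thesis
    proof (rule simulatesI[OF \<phi>(1), of "\<phi>((u, t) := \<phi> e)"])
      show "inj_on (\<phi>((u, t) := \<phi> e)) (E - {e} \<union> {(u, t)} - siblings R')"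
        using \<phi>(2) inj False by (auto simp: inj_on_def dest: sym)
      fix x assume x: "x \<in> E - {e} \<union> {(u, t)}" "x \<notin> siblings R'"
      show "(\<phi>((u, t) := \<phi> e)) x \<in> E' \<and> ((\<phi>((u, t) := \<phi> e)) x, x) \<in> (simp_eq R')\<^sup>*"
      proof (cases "x = (u, t)")
        case True
        then show ?thesis using \<phi>(3)[OF e(1) es] path by (auto intro: rtrancl_trans)
      next
        case False
        then show ?thesis using x \<phi>(3) by auto
      qed
    qed
  qed
qed

text \<open>The reductions from a common source to \<open>s\<close> and \<open>t\<close> begin with
  two single steps, whose results Deduce can equate; Simplify does the rest. All equations on this
  path are siblings, so no ancestor of a non-sibling is consumed.\<close>

lemma KB_orient_sibling:
  assumes st: "(s, t) \<in> siblings R" and gt: "(s, t) \<in> gt"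
  shows "\<exists>E'. KBs (E, R) (E', R \<union> {(s, t)}) \<and> E - siblings R \<subseteq> E'"
proof -
  from st obtain w where "(w, s) \<in> reducts R" "(w, t) \<in> reducts R" by (auto simp: siblings_def)
  then obtain a b a' b' where w: "(w, a) \<in> conv (AC F)" "(a, b) \<in> rstep R" "(b, s) \<in> (rew R)\<^sup>*"
    "(w, a') \<in> conv (AC F)" "(a', b') \<in> rstep R" "(b', t) \<in> (rew R)\<^sup>*"
    unfolding reducts_def by blast
  have aa: "(a, a') \<in> conv (AC F)" using conv_trans[OF conv_sym[OF w(1)] w(4)] .
  then have "(b, b') \<in> (rstep R)\<inverse> O conv (AC F) O rstep R" using w by blast
  then have KB: "KBAC_step F gt (E, R) (E \<union> {(b, b')}, R)" by (rule KBAC_step.deduce)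
  have "(a, b) \<in> reducts R" "(a, b') \<in> reducts R"
    using w aa by (blast intro: rstep_reducts conv_reducts)+
  then have sib: "(b, b') \<in> siblings R" by (auto simp: siblings_def)
  from simp_eq_both[OF w(3,6)] obtain x where x: "x = (s, t) \<or> x = (t, s)"
    "((b, b'), x) \<in> (simp_eq R)\<^sup>*" by blast
  from rtrancl_path[OF this(2)] obtain k f where
    f: "f 0 = (b, b')" "f k = x" "\<forall>i < k. (f i, f (Suc i)) \<in> simp_eq R" .
  have f_sib: "i \<le> k \<Longrightarrow> f i \<in> siblings R" for i
  proof (induction i)
    case (Suc i)
    then have "(f i, f (Suc i)) \<in> simp_eq R" using f(3) by simp
    then show ?case using siblings_simp[of "f i" "f (Suc i)"] Suc by auto
  qed (use f sib in simp)
  from KB_simplify_path[OF _ f(3), of "E \<union> {(b, b')}"] f obtain E' where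
    E': "KBs (E \<union> {(b, b')}, R) (E', R)" "x \<in> E'" "E \<union> {(b, b')} - f ` {..k} \<subseteq> E'" by auto
  have "KBAC_step F gt (E', R) (E' - {x}, R \<union> {(s, t)})"
    using E'(2) x(1) gt by (rule KBAC_step.orient)
  then have "KBs (E, R) (E' - {x}, R \<union> {(s, t)})"
    using KB E'(1) by (meson converse_rtranclp_into_rtranclp rtranclp.rtrancl_into_rtrancl)
  moreover have "E - siblings R \<subseteq> E' - {x}" using E'(3) f_sib f(2) by auto
  ultimately show ?thesis by blast
qed

text \<open>Taking the last member of \<open>E\<close> on the simplification path avoids identifying
  the equation under way with another one.\<close>

lemma KB_orient_descendant:
  assumes c: "c \<in> E" "(c, e) \<in> (simp_eq R)\<^sup>*" and e: "e = (s, t) \<or> e = (t, s)" and gt: "(s, t) \<in> gt"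
  shows "\<exists>c' E'. (c, c') \<in> (simp_eq R)\<^sup>* \<and> KBs (E, R) (E', R \<union> {(s, t)}) \<and> E - {c'} \<subseteq> E'"
proof -
  let ?P = "\<lambda>k. \<exists>c' \<in> E. (c, c') \<in> (simp_eq R)\<^sup>* \<and> (c', e) \<in> simp_eq R ^^ k"
  have "\<exists>k. ?P k" using c by (metis rtrancl.rtrancl_refl rtrancl_imp_relpow)
  then obtain k where k: "?P k" "\<And>j. j < k \<Longrightarrow> \<not> ?P j" using exists_least_iff[of ?P] by metis
  then obtain c' f where c': "c' \<in> E" "(c, c') \<in> (simp_eq R)\<^sup>*"
    and f: "f 0 = c'" "f k = e" "\<forall>i < k. (f i, f (Suc i)) \<in> simp_eq R"
    by (auto simp: relpow_fun_conv)
  have reach: "i \<le> k \<Longrightarrow> (c', f i) \<in> (simp_eq R)\<^sup>*" for i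
  proof (induction i)
    case (Suc i)
    then show ?case using f(3) by (auto intro: rtrancl_into_rtrancl)
  qed (use f in simp)
  have fresh: "f i \<notin> E" if i: "0 < i" "i \<le> k" for i
  proof
    assume "f i \<in> E"
    moreover have "(c, f i) \<in> (simp_eq R)\<^sup>*" using c'(2) reach[OF i(2)] by (rule rtrancl_trans)
    moreover have "(f i, e) \<in> simp_eq R ^^ (k - i)"
      unfolding relpow_fun_conv using f i by (intro exI[of _ "\<lambda>j. f (i + j)"]) auto
    ultimately have "?P (k - i)" by blast
    then show False using k(2)[of "k - i"] i by auto
  qed
  from KB_simplify_path[OF _ f(3), of E] f c' obtain E' where
    E': "KBs (E, R) (E', R)" "e \<in> E'" "E - f ` {..k} \<subseteq> E'" by auto
  have "KBAC_step F gt (E', R) (E' - {e}, R \<union> {(s, t)})"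
    using E'(2) e gt by (rule KBAC_step.orient)
  then have "KBs (E, R) (E' - {e}, R \<union> {(s, t)})" using E'(1) by simp
  moreover have "E - {c'} \<subseteq> E' - {e}"
  proof
    fix x assume x: "x \<in> E - {c'}"
    then have "x \<notin> f ` {..k}" using fresh f(1)
      by (metis DiffD1 DiffD2 atMost_iff bot_nat_0.not_eq_extremum imageE singletonI)
    then show "x \<in> E' - {e}" using x E'(3) f(2) by auto
  qed
  ultimately show ?thesis using c'(2) by blast
qed

lemma simulates_orient:
  assumes sim: "simulates (E', R') (E, R)" and e: "e \<in> E" "e = (s, t) \<or> e = (t, s)"
    and gt: "(s, t) \<in> gt"
  shows "\<exists>E2. KBs (E', R') (E2, R' \<union> {(s, t)}) \<and>
    simulates (E2, R' \<union> {(s, t)}) (E - {e}, R \<union> {(s, t)})"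
proof -
  let ?R = "R' \<union> {(s, t)}"
  from sim obtain \<phi> where \<phi>: "R \<subseteq> reducts R'" "inj_on \<phi> (E - siblings R')"
    "\<And>e. e \<in> E \<Longrightarrow> e \<notin> siblings R' \<Longrightarrow> \<phi> e \<in> E' \<and> (\<phi> e, e) \<in> (simp_eq R')\<^sup>*"
    by (elim simulatesE that)
  have R: "R \<union> {(s, t)} \<subseteq> reducts ?R"
    using \<phi>(1) reducts_mono[of R' ?R] rstep_reducts[OF rstep_rule, of s t ?R] by blast
  have sib: "siblings R' \<subseteq> siblings ?R" by (rule siblings_mono) blast
  have simp: "(simp_eq R')\<^sup>* \<subseteq> (simp_eq ?R)\<^sup>*" by (intro rtrancl_mono simp_eq_mono) blast
  show ?thesis
  proof (cases "e \<in> siblings R'")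
    case True
    then have "(s, t) \<in> siblings R'" using e(2) siblings_sym by blast
    from KB_orient_sibling[OF this gt] obtain E2 where
      E2: "KBs (E', R') (E2, ?R)" "E' - siblings R' \<subseteq> E2" by blast
    have "simulates (E2, ?R) (E - {e}, R \<union> {(s, t)})"
    proof (rule simulatesI[OF R])
      show "inj_on \<phi> (E - {e} - siblings ?R)" using \<phi>(2) sib by (blast intro: inj_on_subset)
      fix x assume "x \<in> E - {e}" "x \<notin> siblings ?R"
      then have x: "x \<in> E" "x \<notin> siblings R'" using sib by auto
      then have "\<phi> x \<notin> siblings R'" using \<phi>(3) siblings_simp by blast
      then show "\<phi> x \<in> E2 \<and> (\<phi> x, x) \<in> (simp_eq ?R)\<^sup>*" using \<phi>(3)[OF x] E2(2) simp by blast
    qed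
    then show ?thesis using E2(1) by blast
  next
    case False
    have c: "\<phi> e \<in> E'" "(\<phi> e, e) \<in> (simp_eq R')\<^sup>*" using \<phi>(3)[OF e(1) False] by auto
    from KB_orient_descendant[OF c e(2) gt] obtain c' E2 where
      c': "(\<phi> e, c') \<in> (simp_eq R')\<^sup>*" and E2: "KBs (E', R') (E2, ?R)" "E' - {c'} \<subseteq> E2" by blast
    \<comment> \<open>The consumed \<open>c'\<close> may be the ancestor of another equation. That
      equation inherits \<open>\<phi> e\<close>, which is free once \<open>e\<close> is oriented,
      still present, and simplifies to \<open>c'\<close>.\<close>
    define \<psi> where "\<psi> x = (if \<phi> x = c' then \<phi> e else \<phi> x)" for x
    have inj: "\<phi> x = \<phi> y \<Longrightarrow> x = y"
      if "x \<in> E" "x \<notin> siblings R'" "y \<in> E" "y \<notin> siblings R'" for x y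
      using \<phi>(2) that by (auto simp: inj_on_def)
    have "simulates (E2, ?R) (E - {e}, R \<union> {(s, t)})"
    proof (rule simulatesI[OF R])
      show "inj_on \<psi> (E - {e} - siblings ?R)"
      proof (rule inj_onI)
        fix x y assume "x \<in> E - {e} - siblings ?R" "y \<in> E - {e} - siblings ?R" and eq: "\<psi> x = \<psi> y"
        then have xy: "x \<in> E" "x \<noteq> e" "x \<notin> siblings R'" "y \<in> E" "y \<noteq> e" "y \<notin> siblings R'"
          using sib by auto
        have "\<phi> x \<noteq> \<phi> e" "\<phi> y \<noteq> \<phi> e" using inj[OF _ _ e(1) False] xy by blast+
        then have "\<phi> x = \<phi> y" using eq by (auto simp: \<psi>_def split: if_splits)
        then show "x = y" using inj xy by blast
      qed
      fix x assume "x \<in> E - {e}" "x \<notin> siblings ?R"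
      then have x: "x \<in> E" "x \<notin> siblings R'" "x \<noteq> e" using sib by auto
      have ne: "\<phi> x \<noteq> \<phi> e" using inj[OF x(1,2) e(1) False] x(3) by blast
      have "\<psi> x \<in> E' - {c'}" using ne \<phi>(3)[OF x(1,2)] c(1) by (auto simp: \<psi>_def)
      moreover have "(\<psi> x, x) \<in> (simp_eq R')\<^sup>*"
        using \<phi>(3)[OF x(1,2)] c' by (auto simp: \<psi>_def intro: rtrancl_trans)
      ultimately show "\<psi> x \<in> E2 \<and> (\<psi> x, x) \<in> (simp_eq ?R)\<^sup>*" using E2(2) simp by blast
    qed
    then show ?thesis using E2(1) by blast
  qed
qed

lemma simulation_step:
  assumes step: "IA_step (AC F) gt (E, R) (E2, R2)" and sim: "simulates (E', R') (E, R)"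
  shows "\<exists>S. KBs (E', R') S \<and> simulates S (E2, R2)"
proof -
  have R: "R \<subseteq> reducts R'" using sim by (rule simulatesE)
  have rstepR: "rstep R1 \<subseteq> reducts R'" if "R1 \<subseteq> R" for R1
    using rstep_least[OF stable_reducts] R that by blast
  have stay: ?thesis if "R2 \<subseteq> reducts R'" "E2 \<subseteq> E \<union> siblings R'"
    using simulates_antimono[OF sim that] by blast
  from step show ?thesis
  proof cases
    case (deduce_peak s t)
    then have "(s, t) \<in> siblings R'" using rstepR[of R] unfolding siblings_def by blast
    then show ?thesis using deduce_peak R by (intro stay) auto
  next
    case (deduce_cliff s t)
    then obtain u where u: "(u, s) \<in> rstep R" "(u, t) \<in> sstep (AC F)" by blast
    have "(t, u) \<in> conv (AC F)" using u(2) by (auto simp: conv_def dest: sstep_sym)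
    then have "(t, s) \<in> reducts R'" using conv_reducts u(1) rstepR[of R] by blast
    then show ?thesis using deduce_cliff R by (intro stay) auto
  next
    case (orient e s t)
    then show ?thesis using simulates_orient[OF sim orient(3,4,5)] by blast
  next
    \<comment> \<open>Any ancestor stays behind in \<open>E'\<close>, as a surplus equation for the
      final clean-up.\<close>
    case (delete s t)
    then show ?thesis using R by (intro stay) auto
  next
    case (simplify e s t u)
    then show ?thesis using simulates_simplify[OF sim simplify(3,4,5)] by blast
  next
    case (collapse s t u)
    have "(s, u) \<in> reducts R'" "(s, t) \<in> reducts R'"
      using collapse R rstepR[of "R - {(s, t)}"] by auto
    then have "(u, t) \<in> siblings R'" by (auto simp: siblings_def)
    then show ?thesis using collapse R by (intro stay) auto
  next
    case (compose s t u)
    have "(t, u) \<in> (rew R')\<^sup>+"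
      using R compose(4) by (intro relmod_reducts_trancl[of "R - {(s, t)}"]) auto
    moreover have "(s, t) \<in> reducts R'" using R compose by blast
    ultimately have "(s, u) \<in> reducts R'" by (rule reducts_rew[rotated, OF trancl_into_rtrancl])
    then show ?thesis using compose R by (intro stay) auto
  qed
qed

lemma simulation:
  assumes "run (IA_step (AC F) gt) E S n"
  shows "\<exists>S'. KBs (E, {}) S' \<and> simulates S' (S n)"
proof -
  have "i \<le> n \<Longrightarrow> \<exists>S'. KBs (E, {}) S' \<and> simulates S' (S i)" for i
  proof (induction i)
    case 0
    have "simulates (E, {}) (E, {})" by (rule simulatesI[of _ _ id]) auto
    then show ?case using assms by (auto simp: run_def)
  next
    case (Suc i)
    then obtain E' R' where S': "KBs (E, {}) (E', R')" "simulates (E', R') (S i)"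
      by (metis Suc_leD surj_pair)
    have "IA_step (AC F) gt (fst (S i), snd (S i)) (fst (S (Suc i)), snd (S (Suc i)))"
      using assms Suc.prems by (simp add: run_def)
    from simulation_step[OF this, of E' R'] S'(2) obtain S'' where
      "KBs (E', R') S''" "simulates S'' (S (Suc i))" by auto
    then show ?case using S'(1) by (meson rtranclp_trans)
  qed
  then show ?thesis by blast
qed

text \<open>Rewriting both sides to AC-equivalent terms makes an equation deletable. Its path leaves
  no other new equation behind, so the set shrinks strictly.\<close>

lemma KB_discharge:
  assumes "finite E" "E \<subseteq> (rew R)\<^sup>* O conv (AC F) O ((rew R)\<inverse>)\<^sup>*"
  shows "KBs (E, R) ({}, R)"
  using assms
proof (induction E rule: finite_psubset_induct)
  case (psubset E)
  show ?case
  proof (cases "E = {}")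
    case False
    then obtain s t where st: "(s, t) \<in> E" by auto
    then obtain a b where ab: "(s, a) \<in> (rew R)\<^sup>*" "(a, b) \<in> conv (AC F)" "(t, b) \<in> (rew R)\<^sup>*"
      using psubset.prems by (auto simp: rtrancl_converse)
    from simp_eq_both[OF ab(1,3)] obtain x where x: "x = (a, b) \<or> x = (b, a)"
      "((s, t), x) \<in> (simp_eq R)\<^sup>*" by blast
    from rtrancl_path[OF this(2)] obtain k f where
      f: "f 0 = (s, t)" "f k = x" "\<forall>i < k. (f i, f (Suc i)) \<in> simp_eq R" .
    from KB_simplify_path[OF _ f(3), of E] f st obtain E' where
      E': "KBs (E, R) (E', R)" "x \<in> E'" "E' \<subseteq> E - {(s, t)} \<union> {x}" by auto
    obtain x1 x2 where x12: "x = (x1, x2)" by (cases x)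
    have "(x1, x2) \<in> conv (AC F)" using x(1) x12 ab(2) conv_sym by auto
    then have "KBAC_step F gt (E', R) (E' - {x}, R)"
      using E'(2) unfolding x12 by (intro KBAC_step.delete)
    moreover have "E' - {x} \<subset> E" using E'(3) st by blast
    moreover then have "KBs (E' - {x}, R) ({}, R)" using psubset by blast
    ultimately show ?thesis using E'(1)
      by (meson converse_rtranclp_into_rtranclp rtranclp_trans)
  qed simp
qed

section \<open>Soundness of AC completion and finiteness of the initial equations\<close>

lemma KB_step_invariant:
  assumes "KBAC_step F gt (E1, R1) (E2, R2)"
    and "finite E1" "R1 \<subseteq> gt" "E1 \<union> R1 \<subseteq> conv (E \<union> AC F)"
  shows "finite E2 \<and> R2 \<subseteq> gt \<and> E2 \<union> R2 \<subseteq> conv (E \<union> AC F)"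
proof -
  let ?C = "conv (E \<union> AC F)"
  have ac: "conv (AC F) \<subseteq> ?C" by (rule conv_mono) blast
  have rstep: "rstep R \<subseteq> ?C" if "R \<subseteq> R1" for R
    using rstep_least[OF stable_conv] that assms(4) by blast
  have rew: "rew R \<subseteq> ?C" if "R \<subseteq> R1" for R
    unfolding relmod_def using rstep[OF that] ac by (blast intro: conv_trans)
  from assms(1) show ?thesis
  proof cases
    case (deduce s t)
    then obtain a b where "(a, s) \<in> ?C" "(a, b) \<in> ?C" "(b, t) \<in> ?C" using rstep[of R1] ac by blast
    then have "(s, t) \<in> ?C" using conv_sym conv_trans by metis
    then show ?thesis using deduce assms by auto
  next
    case (orient e s t)
    then have "(s, t) \<in> ?C" using assms(4) conv_sym by blast
    then show ?thesis using orient assms by auto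
  next
    case (delete s t)
    then show ?thesis using assms by auto
  next
    case (simplify e s t u)
    then have "(s, t) \<in> ?C" "(s, u) \<in> ?C" using assms(4) rew[of R1] conv_sym by blast+
    then have "(u, t) \<in> ?C" using conv_sym conv_trans by metis
    then show ?thesis using simplify assms by auto
  next
    case (collapse s t u)
    then have "(s, t) \<in> ?C" "(s, u) \<in> ?C" using assms(4) rew[of "R1 - {(s, t)}"] by blast+
    then have "(u, t) \<in> ?C" using conv_sym conv_trans by metis
    then show ?thesis using collapse assms by auto
  next
    case (compose s t u)
    then have "(s, t) \<in> ?C" "(t, u) \<in> ?C" using assms(4) rew[of "R1 - {(s, t)}"] by blast+
    then have "(s, u) \<in> ?C" using conv_trans by metis
    moreover have "(s, u) \<in> gt"
      using relmod_gt[of "R1 - {(s, t)}"] compose assms(3) gt_trans by blast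
    ultimately show ?thesis using compose assms by auto
  qed
qed

lemma KBs_invariant:
  assumes "KBs (E, {}) (E', R')" "finite E"
  shows "finite E'" "R' \<subseteq> gt" "E' \<union> R' \<subseteq> conv (E \<union> AC F)"
proof -
  have "finite (fst S) \<and> snd S \<subseteq> gt \<and> fst S \<union> snd S \<subseteq> conv (E \<union> AC F)" if "KBs (E, {}) S" for S
    using that
  proof (induction rule: rtranclp_induct)
    case base
    have "E \<subseteq> conv (E \<union> AC F)" by (auto intro: rstep_conv rstep_rule)
    then show ?case using assms(2) by simp
  next
    case (step S S')
    then show ?case
      using KB_step_invariant[of "fst S" "snd S" "fst S'" "snd S'" E] by simp
  qed
  from this[OF assms(1)] show "finite E'" "R' \<subseteq> gt" "E' \<union> R' \<subseteq> conv (E \<union> AC F)" by auto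
qed

lemma IA_step_finite:
  assumes "IA_step (AC F) gt (E, R) (E', R')" "finite E'"
  shows "finite E"
  using assms by cases auto

text \<open>A step removes at most one equation, so finitely many steps cannot exhaust an infinite
  set; finiteness of \<open>E\<close> is forced by the end of the run.\<close>

lemma IA_run_finite:
  assumes "run (IA_step (AC F) gt) E S n" "finite (fst (S n))"
  shows "finite E"
proof -
  have "finite (fst (S 0))"
  proof (rule inc_induct[of 0 n])
    fix i assume "i < n" "finite (fst (S (Suc i)))"
    then show "finite (fst (S i))"
      using IA_step_finite[of "fst (S i)" "snd (S i)"] assms(1)
      by (metis run_def prod.collapse)
  qed (use assms in auto)
  then show ?thesis using assms(1) by (simp add: run_def)
qed

end

theorem theorem7p5:
  fixes F :: "'f set" and gt :: "('f, 'v) term rel"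
    and E R :: "('f, 'v) trs" and S :: "nat \<Rightarrow> ('f, 'v) state" and n :: nat
  assumes "infinite (UNIV :: 'v set)"
    and "reduction_order_mod (AC F) gt"
    and "run (IA_step (AC F) gt) E S n"
    and "S n = ({}, R)"
    and "fair_run (AC F) S n"
  shows "\<exists>S' m R'. run (KBAC_step F gt) E S' m \<and> S' m = ({}, R') \<and>
           SN_rel (relmod R' (AC F)) \<and>
           conv (E \<union> AC F) = conv (R' \<union> AC F) \<and>
           conv (R' \<union> AC F) \<subseteq>
             (relmod R' (AC F))\<^sup>* O conv (AC F) O ((relmod R' (AC F))\<inverse>)\<^sup>*"
proof -
  interpret ac_reduction_order F gt using assms(1,2) by unfold_locales
  have cr: "conv (R \<union> AC F) \<subseteq> join_mod R (AC F)" and E_R: "E \<subseteq> conv (R \<union> AC F)"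
    using fair_run_church_rosser[OF assms(3-5)] by auto
  have fin: "finite E" using IA_run_finite[OF assms(3)] assms(4) by simp
  from simulation[OF assms(3)] obtain E' R' where
    sim: "KBs (E, {}) (E', R')" "simulates (E', R') ({}, R)" using assms(4) by auto
  note inv = KBs_invariant[OF sim(1) fin]
  have R: "R \<subseteq> reducts R'" using sim(2) by (rule simulatesE)
  let ?V = "(rew R')\<^sup>* O conv (AC F) O ((rew R')\<inverse>)\<^sup>*"
  have AC: "AC F \<subseteq> conv (X \<union> AC F)" for X by (auto intro: rstep_conv rstep_rule)
  \<comment> \<open>The inclusions from \<open>R\<close> to \<open>R'\<close>, from
    \<open>R'\<close> to \<open>E\<close> and from \<open>E\<close> to \<open>R\<close> close a
    cycle. So the three theories agree, and a conversion over any of them has a valley of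
    \<open>R\<close>, which becomes one of \<open>R'\<close> because rules of \<open>R\<close> are
    \<open>reducts\<close> of \<open>R'\<close>.\<close>
  have "rew R' \<subseteq> conv (R' \<union> AC F)" by (rule relmod_subset_conv)
  then have "(rew R')\<^sup>* \<subseteq> conv (R' \<union> AC F)"
    unfolding conv_def by (rule rtrancl_subset_rtrancl)
  then have "R \<subseteq> conv (R' \<union> AC F)"
    using R by (auto dest!: reducts_trancl trancl_into_rtrancl)
  then have "conv (R \<union> AC F) \<subseteq> conv (R' \<union> AC F)" using AC by (intro conv_least) blast
  moreover have "conv (R' \<union> AC F) \<subseteq> conv (E \<union> AC F)" using AC inv(3) by (intro conv_least) blast
  moreover have "conv (E \<union> AC F) \<subseteq> conv (R \<union> AC F)" using AC E_R by (intro conv_least) blast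
  ultimately have eq: "conv (R' \<union> AC F) = conv (E \<union> AC F)" "conv (R \<union> AC F) = conv (E \<union> AC F)" by auto
  have "rstep R \<subseteq> (rew R')\<^sup>*"
    using rstep_least[OF stable_reducts R] by (auto dest: reducts_trancl trancl_into_rtrancl)
  then have "(rstep R)\<^sup>* \<subseteq> (rew R')\<^sup>*" by (rule rtrancl_subset_rtrancl)
  then have "join_mod R (AC F) \<subseteq> ?V" unfolding join_mod_def rtrancl_converse by blast
  then have valley: "conv (E \<union> AC F) \<subseteq> ?V" using cr eq by blast
  have "KBs (E', R') ({}, R')" using KB_discharge[OF inv(1)] inv(3) valley by blast
  then have "KBs (E, {}) ({}, R')" using sim(1) by simp
  from rtranclp_imp_relpowp[OF this] obtain m S' where "S' 0 = (E, {})" "S' m = ({}, R')"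
    "\<forall>i < m. KBAC_step F gt (S' i) (S' (Suc i))" unfolding relpowp_fun_conv by blast
  then have "run (KBAC_step F gt) E S' m" "S' m = ({}, R')" by (auto simp: run_def)
  moreover have "SN_rel (rew R')"
    using relmod_gt[OF inv(2)] gt_wf unfolding SN_rel_def wf_iff_no_infinite_down_chain by blast
  ultimately show ?thesis using eq valley by metis
qed

end
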